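(* Let $\mathbb{K}$ be a field of characteristic $0$ and $\lambda\in\mathbb{K}$ nonzero. Let $(A_\mu,B_\nu^{l,r},P)$ be a relative averaging algebra of weight $\lambda$. Then for any linear maps $\mu':A\otimes A\to A$, $\nu':B\otimes B\to B$, $l':A\otimes B\to B$, $r':B\otimes A\to B$ and $P':B\to A$, the structure $(A_{\mu+\mu'},B_{\nu+\nu'}^{l+l',r+r'},P+P')$ is a relative averaging algebra of weight $\lambda$ if and only if $(s^{-1}\pi'_\lambda,P')\in(s^{-1}\mathfrak{h}\oplus\mathfrak{a})_0$ is a Maurer-Cartan element of the twisted $L_\infty$-algebra $\big(s^{-1}\mathfrak{h}\oplus\mathfrak{a},\{l_k^{(s^{-1}\pi_\lambda,P)}\}_{k=1}^\infty\big)$, where $\pi_\lambda$ is the element associated with $(\mu,\nu,l,r)$ and $\pi'_\lambda$ the element associated with $(\mu',\nu',l',r')$.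
   Context: Bimodules and operators. $A_\mu$ denotes $A$ with product $ab=\mu(a,b)$. $B_\nu^{l,r}$ is an associative $A_\mu$-bimodule if $xy=\nu(x,y)$ is associative and, with $a\cdot x=l(a,x)$, $x\cdot a=r(x,a)$: $(ab)\cdot x=a\cdot(b\cdot x)$, $(a\cdot x)\cdot b=a\cdot(x\cdot b)$, $(x\cdot a)\cdot b=x\cdot(ab)$, $(xy)\cdot a=x(y\cdot a)$, $(x\cdot a)y=x(a\cdot y)$, $(a\cdot x)y=a\cdot(xy)$ for $a,b\in A$, $x,y\in B$. $(A_\mu,B_\nu^{l,r},P)$ is a relative averaging algebra of weight $\lambda$ if $A_\mu$ is an associative algebra, $B_\nu^{l,r}$ is an associative $A_\mu$-bimodule and $P:B\to A$ is linear with $P(x)P(y)=P(P(x)\cdot y)=P(x\cdot P(y))=\lambda P(xy)$ for all $x,y\in B$. Trees. For $n\ge1$, $T_n$ is the set of planar rooted trees with $n+1$ leaves in which every internal vertex has at least two incoming edges. Leaves are labelled $0,\dots,n$ from left to right; deleting a leaf suppresses a vertex left with a single incoming edge. For $m,n\ge1$, $1\le i\le m$, $T\in T_{m+n-1}$: $R_0^{m;i,n}(T)\in T_m$ is obtained by deleting the leaves $i,\dots,i+n-2$, and $R_i^{m;i,n}(T)\in T_n$ by deleting all leaves except $i-1,\dots,i+n-1$. $T_1$ has one element. $T_2=\{T^{\dashv},T^{\vdash},T^{\perp}\}$: in $T^{\dashv}$ leaves 1,2 are joined at a vertex above the root vertex, in $T^{\vdash}$ leaves 0,1 are, and $T^{\perp}$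 has one vertex with three leaves. Graded Lie algebra. With $D=A\oplus B$, $C^n(D,D)=\mathrm{Hom}(\mathbb{K}[T_n]\otimes D^{\otimes n},D)$ and $\mathfrak{g}=\bigoplus_{n\ge0}C^{n+1}(D,D)$ ($C^{n+1}$ in degree $n$), with bracket, for $f\in C^m$, $g\in C^n$, $$[f,g]=\sum_{i=1}^m(-1)^{(i-1)(n-1)}f\circ_ig-(-1)^{(m-1)(n-1)}\sum_{i=1}^n(-1)^{(i-1)(m-1)}g\circ_if,$$ $$(f\circ_ig)(T;x_1,\dots,x_{m+n-1})=f\big(R_0^{m;i,n}(T);x_1,\dots,x_{i-1},g(R_i^{m;i,n}(T);x_i,\dots,x_{i+n-1}),x_{i+n},\dots,x_{m+n-1}\big).$$ Let $\mathcal{A}^{k,l}$ be the direct sum of all $(k+l)$-fold tensor products of $A$'s and $B$'s with $A$ appearing $k$ times and $B$ appearing $l$ times. Let $\mathfrak{a}=\bigoplus_{n\ge0}\mathrm{Hom}(\mathbb{K}[T_{n+1}]\otimes B^{\otimes n+1},A)\subset\mathfrak{g}$, $p:\mathfrak{g}\to\mathfrak{g}$ the natural projection onto $\mathfrak{a}$, and $$\mathfrak{h}=\bigoplus_{n\ge0}\Big(\mathrm{Hom}(\mathbb{K}[T_{n+1}]\otimes A^{\otimes n+1},A)\oplus\bigoplus_{k+l=n+1,\,k\ge0,\,l>0}\mathrm{Hom}(\mathbb{K}[T_{n+1}]\otimes\mathcal{A}^{k,l},B)\Big),$$ a graded Lie subalgebra of $\mathfrak{g}$. The element $\pi_\lambda\in\mathfrak{h}_1$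 associated with linear maps $(\mu,\nu,l,r)$ is given by $\pi_\lambda(T^{\dashv};(a,x),(b,y))=(\mu(a,b),r(x,b))$, $\pi_\lambda(T^{\vdash};(a,x),(b,y))=(\mu(a,b),l(a,y))$, $\pi_\lambda(T^{\perp};(a,x),(b,y))=(\mu(a,b),\lambda\nu(x,y))$. $L_\infty$-algebras. An $L_\infty$-algebra is a graded vector space $\mathcal{L}$ with degree $1$ graded symmetric maps $l_k:\mathcal{L}^{\otimes k}\to\mathcal{L}$, $k\ge1$, satisfying $\sum_{i+j=n+1}\sum_{\sigma\in Sh(i,n-i)}\pm l_j(l_i(x_{\sigma(1)},\dots,x_{\sigma(i)}),x_{\sigma(i+1)},\dots,x_{\sigma(n)})=0$ (Koszul signs) for all $n\ge1$. A Maurer-Cartan element is $\alpha\in\mathcal{L}_0$ with $\sum_{k\ge1}\frac1{k!}l_k(\alpha,\dots,\alpha)=0$. For a Maurer-Cartan element $\alpha$, the twisted $L_\infty$-algebra has structure maps $l_k^\alpha(x_1,\dots,x_k)=\sum_{n\ge0}\frac1{n!}l_{n+k}(\alpha,\dots,\alpha,x_1,\dots,x_k)$. The $L_\infty$-structure on $s^{-1}\mathfrak{h}\oplus\mathfrak{a}$ (where $(s^{-1}\mathfrak{h})_n=\mathfrak{h}_{n+1}$) is $$l_2\big((s^{-1}f,0),(s^{-1}g,0)\big)=\big((-1)^{|f|}s^{-1}[f,g],0\big),$$ $$l_k\big((s^{-1}f,0),(0,h_1),\dots,(0,h_{k-1})\big)=\big(0,p[\cdots[[f,h_1],h_2],\dots,h_{k-1}]\big)\quad(k\ge2),$$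 for homogeneous $f,g\in\mathfrak{h}$, $h_i\in\mathfrak{a}$; up to permutation of inputs all other maps vanish. For a relative averaging algebra $(A_\mu,B_\nu^{l,r},P)$ of weight $\lambda$, $(s^{-1}\pi_\lambda,P)$ is a Maurer-Cartan element of it. *)

theory Defs
  imports Complex_Main "HOL-Library.Function_Algebras" "HOL-Library.Product_Plus"
begin

section \<open>Relative averaging algebras\<close>

text \<open>
  Vector spaces over a field \<open>'k\<close> are given by a type of vectors together with a scalar
  multiplication satisfying the locale predicate \<^const>\<open>vector_space\<close>.  A linear map out of a
  tensor product of two spaces is rendered as a bilinear map.
\<close>

definition bilin ::
  "('k::field \<Rightarrow> 'u::ab_group_add \<Rightarrow> 'u) \<Rightarrow> ('k \<Rightarrow> 'v::ab_group_add \<Rightarrow> 'v) \<Rightarrow>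
   ('k \<Rightarrow> 'w::ab_group_add \<Rightarrow> 'w) \<Rightarrow> ('u \<Rightarrow> 'v \<Rightarrow> 'w) \<Rightarrow> bool"
  where "bilin sU sV sW b \<longleftrightarrow>
    (\<forall>u. Vector_Spaces.linear sV sW (b u)) \<and>
    (\<forall>v. Vector_Spaces.linear sU sW (\<lambda>u. b u v))"

definition associative_algebra ::
  "('k::field \<Rightarrow> 'a::ab_group_add \<Rightarrow> 'a) \<Rightarrow> ('a \<Rightarrow> 'a \<Rightarrow> 'a) \<Rightarrow> bool"
  where "associative_algebra sA \<mu> \<longleftrightarrow>
    bilin sA sA sA \<mu> \<and> (\<forall>a b c. \<mu> (\<mu> a b) c = \<mu> a (\<mu> b c))"

definition associative_bimodule ::
  "('k::field \<Rightarrow> 'a::ab_group_add \<Rightarrow> 'a) \<Rightarrow> ('k \<Rightarrow> 'b::ab_group_add \<Rightarrow> 'b) \<Rightarrow>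
   ('a \<Rightarrow> 'a \<Rightarrow> 'a) \<Rightarrow> ('b \<Rightarrow> 'b \<Rightarrow> 'b) \<Rightarrow> ('a \<Rightarrow> 'b \<Rightarrow> 'b) \<Rightarrow> ('b \<Rightarrow> 'a \<Rightarrow> 'b) \<Rightarrow> bool"
  where "associative_bimodule sA sB \<mu> \<nu> l r \<longleftrightarrow>
    associative_algebra sB \<nu> \<and> bilin sA sB sB l \<and> bilin sB sA sB r \<and>
    (\<forall>a b x. l (\<mu> a b) x = l a (l b x)) \<and>
    (\<forall>a b x. r (l a x) b = l a (r x b)) \<and>
    (\<forall>a b x. r (r x a) b = r x (\<mu> a b)) \<and>
    (\<forall>a x y. r (\<nu> x y) a = \<nu> x (r y a)) \<and>
    (\<forall>a x y. \<nu> (r x a) y = \<nu> x (l a y)) \<and>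
    (\<forall>a x y. \<nu> (l a x) y = l a (\<nu> x y))"

definition relative_averaging_algebra ::
  "('k::field \<Rightarrow> 'a::ab_group_add \<Rightarrow> 'a) \<Rightarrow> ('k \<Rightarrow> 'b::ab_group_add \<Rightarrow> 'b) \<Rightarrow> 'k \<Rightarrow>
   ('a \<Rightarrow> 'a \<Rightarrow> 'a) \<Rightarrow> ('b \<Rightarrow> 'b \<Rightarrow> 'b) \<Rightarrow> ('a \<Rightarrow> 'b \<Rightarrow> 'b) \<Rightarrow> ('b \<Rightarrow> 'a \<Rightarrow> 'b) \<Rightarrow>
   ('b \<Rightarrow> 'a) \<Rightarrow> bool"
  where "relative_averaging_algebra sA sB wt \<mu> \<nu> l r P \<longleftrightarrow>
    associative_algebra sA \<mu> \<and> associative_bimodule sA sB \<mu> \<nu> l r \<and>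
    Vector_Spaces.linear sB sA P \<and>
    (\<forall>x y. \<mu> (P x) (P y) = P (l (P x) y) \<and>
           P (l (P x) y) = P (r x (P y)) \<and>
           P (r x (P y)) = sA wt (P (\<nu> x y)))"


section \<open>Planar trees\<close>

datatype ptree = Leaf | Node "ptree list"

fun leaves :: "ptree \<Rightarrow> nat" where
  "leaves Leaf = 1"
| "leaves (Node ts) = sum_list (map leaves ts)"

fun reduced :: "ptree \<Rightarrow> bool" where
  "reduced Leaf = True"
| "reduced (Node ts) = (2 \<le> length ts \<and> (\<forall>t\<in>set ts. reduced t))"

definition trees :: "nat \<Rightarrow> ptree set"
  where "trees n = {T. reduced T \<and> leaves T = n + 1}"

text \<open>
  \<open>prune S k T\<close> deletes from \<open>T\<close>, whose leaves carry the labels \<open>k, k+1, \<dots>\<close> from left to right,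
  all leaves with label outside \<open>S\<close>.  A vertex left with one incoming edge is suppressed, and one
  left with none disappears (\<^const>\<open>None\<close> means that nothing remains).
\<close>

fun join :: "ptree list \<Rightarrow> ptree option" where
  "join [] = None"
| "join [t] = Some t"
| "join (t # u # ts) = Some (Node (t # u # ts))"

fun prune :: "nat set \<Rightarrow> nat \<Rightarrow> ptree \<Rightarrow> ptree option"
  and prune_list :: "nat set \<Rightarrow> nat \<Rightarrow> ptree list \<Rightarrow> ptree list" where
  "prune S k Leaf = (if k \<in> S then Some Leaf else None)"
| "prune S k (Node ts) = join (prune_list S k ts)"
| "prune_list S k [] = []"
| "prune_list S k (t # ts) =
    (case prune S k t of None \<Rightarrow> [] | Some t' \<Rightarrow> [t']) @ prune_list S (k + leaves t) ts"

definition R_outer :: "nat \<Rightarrow> nat \<Rightarrow> ptree \<Rightarrow> ptree"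
  where "R_outer i n T = the (prune (- {i..<i+n-1}) 0 T)"

definition R_inner :: "nat \<Rightarrow> nat \<Rightarrow> ptree \<Rightarrow> ptree"
  where "R_inner i n T = the (prune {i-1..i+n-1} 0 T)"

definition T_one :: ptree
  where "T_one = Node [Leaf, Leaf]"

definition T_left :: ptree  \<comment> \<open>the tree labelled by \<open>\<stileturn>\<close>\<close>
  where "T_left = Node [Leaf, Node [Leaf, Leaf]]"

definition T_right :: ptree  \<comment> \<open>the tree labelled by \<open>\<turnstile>\<close>\<close>
  where "T_right = Node [Node [Leaf, Leaf], Leaf]"

definition T_perp :: ptree  \<comment> \<open>the tree labelled by \<open>\<bottom>\<close>\<close>
  where "T_perp = Node [Leaf, Leaf, Leaf]"


section \<open>The graded Lie algebra\<close>

text \<open>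
  \<open>D = A \<oplus> B\<close> is the type \<open>'a \<times> 'b\<close>.  By the universal property of tensor products, an element
  of \<open>Hom(K[T_n] \<otimes> D^{\<otimes> n}, D)\<close> is a family, indexed by \<open>T_n\<close>, of \<open>n\<close>-linear maps on \<open>D\<close>; it is
  stored as a function of a tree and a list of arguments that is zero outside \<open>T_n\<close> and outside
  lists of length \<open>n\<close>.  As a tree determines its number of leaves, elements of the direct sum over
  all \<open>n\<close> are again functions of this type, and addition is the pointwise one.
\<close>

type_synonym ('a, 'b) cochain = "ptree \<Rightarrow> ('a \<times> 'b) list \<Rightarrow> 'a \<times> 'b"

definition scaleD ::
  "('k \<Rightarrow> 'a \<Rightarrow> 'a) \<Rightarrow> ('k \<Rightarrow> 'b \<Rightarrow> 'b) \<Rightarrow> 'k \<Rightarrow> 'a \<times> 'b \<Rightarrow> 'a \<times> 'b"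
  where "scaleD sA sB c x = (sA c (fst x), sB c (snd x))"

definition multilinear ::
  "('k::field \<Rightarrow> 'v::ab_group_add \<Rightarrow> 'v) \<Rightarrow> nat \<Rightarrow> ('v list \<Rightarrow> 'v) \<Rightarrow> bool"
  where "multilinear s n F \<longleftrightarrow>
    (\<forall>xs. length xs = n \<longrightarrow> (\<forall>i<n. Vector_Spaces.linear s s (\<lambda>x. F (xs[i := x]))))"

definition cochains ::
  "('k::field \<Rightarrow> 'a::ab_group_add \<Rightarrow> 'a) \<Rightarrow> ('k \<Rightarrow> 'b::ab_group_add \<Rightarrow> 'b) \<Rightarrow> nat \<Rightarrow>
   ('a, 'b) cochain set"
  where "cochains sA sB n =
    {f. (\<forall>T\<in>trees n. multilinear (scaleD sA sB) n (f T)) \<and>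
        (\<forall>T xs. T \<notin> trees n \<or> length xs \<noteq> n \<longrightarrow> f T xs = 0)}"

definition \<gg>_grade ::
  "('k::field \<Rightarrow> 'a::ab_group_add \<Rightarrow> 'a) \<Rightarrow> ('k \<Rightarrow> 'b::ab_group_add \<Rightarrow> 'b) \<Rightarrow> int \<Rightarrow>
   ('a, 'b) cochain set"
  where "\<gg>_grade sA sB d = (if d < 0 then {0} else cochains sA sB (nat (d + 1)))"

definition in_A :: "'a \<times> 'b::zero \<Rightarrow> bool"
  where "in_A x \<longleftrightarrow> snd x = 0"

definition in_B :: "'a::zero \<times> 'b \<Rightarrow> bool"
  where "in_B x \<longleftrightarrow> fst x = 0"

text \<open>
  A component \<open>Hom(K[T_n] \<otimes> (word in A, B), W)\<close> is embedded in \<open>Hom(K[T_n] \<otimes> D^{\<otimes> n}, D)\<close> by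
  extension by zero on the other words.  Membership in a sum of such components is therefore
  expressed through the values on arguments each of which lies in \<open>A\<close> or in \<open>B\<close>.
\<close>

definition \<aa>_grade ::
  "('k::field \<Rightarrow> 'a::ab_group_add \<Rightarrow> 'a) \<Rightarrow> ('k \<Rightarrow> 'b::ab_group_add \<Rightarrow> 'b) \<Rightarrow> int \<Rightarrow>
   ('a, 'b) cochain set"
  where "\<aa>_grade sA sB d =
    {f \<in> \<gg>_grade sA sB d. \<forall>T xs. (\<forall>x\<in>set xs. in_A x \<or> in_B x) \<longrightarrow>
       (if \<forall>x\<in>set xs. in_B x then in_A (f T xs) else f T xs = 0)}"

definition \<hh>_grade ::
  "('k::field \<Rightarrow> 'a::ab_group_add \<Rightarrow> 'a) \<Rightarrow> ('k \<Rightarrow> 'b::ab_group_add \<Rightarrow> 'b) \<Rightarrow> int \<Rightarrow>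
   ('a, 'b) cochain set"
  where "\<hh>_grade sA sB d =
    {f \<in> \<gg>_grade sA sB d. \<forall>T xs. (\<forall>x\<in>set xs. in_A x \<or> in_B x) \<longrightarrow>
       (if \<forall>x\<in>set xs. in_A x then in_A (f T xs) else in_B (f T xs))}"

text \<open>The homogeneous component of degree \<open>d\<close>, i.e. of arity \<open>d + 1\<close>, of an element of the direct sum.\<close>

definition component :: "int \<Rightarrow> ('a::zero, 'b::zero) cochain \<Rightarrow> ('a, 'b) cochain"
  where "component d f = (\<lambda>T xs. if int (leaves T) = d + 2 then f T xs else 0)"

definition proj_\<aa> :: "('a::zero, 'b::zero) cochain \<Rightarrow> ('a, 'b) cochain"
  where "proj_\<aa> f = (\<lambda>T xs. (fst (f T (map (\<lambda>x. (0, snd x)) xs)), 0))"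

text \<open>\<open>signed e x\<close> is \<open>(-1)^e x\<close>.\<close>

definition signed :: "int \<Rightarrow> 'v::ab_group_add \<Rightarrow> 'v"
  where "signed e x = (if even e then x else - x)"

definition insertion ::
  "nat \<Rightarrow> nat \<Rightarrow> nat \<Rightarrow> ('a::zero, 'b::zero) cochain \<Rightarrow> ('a, 'b) cochain \<Rightarrow> ('a, 'b) cochain"
  where "insertion m i n f g = (\<lambda>T xs.
    if T \<in> trees (m + n - 1) \<and> length xs = m + n - 1
    then f (R_outer i n T)
           (take (i - 1) xs @ [g (R_inner i n T) (take n (drop (i - 1) xs))] @ drop (i - 1 + n) xs)
    else 0)"

definition bracket_hom ::
  "nat \<Rightarrow> nat \<Rightarrow> ('a::ab_group_add, 'b::ab_group_add) cochain \<Rightarrow> ('a, 'b) cochain \<Rightarrow>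
   ('a, 'b) cochain"
  where "bracket_hom m n f g =
    (\<Sum>i=1..m. signed ((int i - 1) * (int n - 1)) (insertion m i n f g)) -
    signed ((int m - 1) * (int n - 1))
      (\<Sum>i=1..n. signed ((int i - 1) * (int m - 1)) (insertion n i m g f))"

text \<open>
  Biadditive extension to the direct sum; only the arities \<open>m\<close>, \<open>n\<close> with \<open>m + n - 1\<close> equal to the
  arity of the tree contribute.
\<close>

definition bracket ::
  "('a::ab_group_add, 'b::ab_group_add) cochain \<Rightarrow> ('a, 'b) cochain \<Rightarrow> ('a, 'b) cochain"
  where "bracket f g = (\<lambda>T xs.
    \<Sum>(m, n) \<in> {(m, n). 1 \<le> m \<and> 1 \<le> n \<and> m + n = leaves T}.
      bracket_hom m n (component (int m - 1) f) (component (int n - 1) g) T xs)"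

definition pi_elt ::
  "('k \<Rightarrow> 'b::zero \<Rightarrow> 'b) \<Rightarrow> 'k \<Rightarrow> ('a::zero \<Rightarrow> 'a \<Rightarrow> 'a) \<Rightarrow> ('b \<Rightarrow> 'b \<Rightarrow> 'b) \<Rightarrow>
   ('a \<Rightarrow> 'b \<Rightarrow> 'b) \<Rightarrow> ('b \<Rightarrow> 'a \<Rightarrow> 'b) \<Rightarrow> ('a, 'b) cochain"
  where "pi_elt sB wt \<mu> \<nu> l r = (\<lambda>T xs.
    (case xs of
       [(a, x), (b, y)] \<Rightarrow>
         (if T = T_left then (\<mu> a b, r x b)
          else if T = T_right then (\<mu> a b, l a y)
          else if T = T_perp then (\<mu> a b, sB wt (\<nu> x y))
          else 0)
     | _ \<Rightarrow> 0))"

text \<open>A linear map \<open>P : B \<rightarrow> A\<close> as an element of degree \<open>0\<close> of \<open>\<aa>\<close>.\<close>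

definition P_elt :: "('b::zero \<Rightarrow> 'a::zero) \<Rightarrow> ('a, 'b) cochain"
  where "P_elt P = (\<lambda>T xs. (case xs of [(a, x)] \<Rightarrow> (if T = T_one then (P x, 0) else 0) | _ \<Rightarrow> 0))"


section \<open>Maurer-Cartan elements and twisting\<close>

text \<open>
  The structure maps \<open>l\<^sub>k\<close> are collected in one function on lists, \<open>k\<close> being the length of the
  list.  The sums over all \<open>k\<close> resp. \<open>n\<close> are sums over their nonzero terms.  In \<open>twist\<close> these
  are finite in number for the structure \<open>L_map\<close> below, when \<open>\<alpha>\<close> has degree \<open>0\<close> and the arguments
  lie in the graded space: an iterated bracket of \<open>f\<close> of arity \<open>m\<close> with more than \<open>m + 1\<close>
  elements of \<open>\<aa>\<close> vanishes.
\<close>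

definition maurer_cartan ::
  "('k::field_char_0 \<Rightarrow> 'v::ab_group_add \<Rightarrow> 'v) \<Rightarrow> (int \<Rightarrow> 'v set) \<Rightarrow> ('v list \<Rightarrow> 'v) \<Rightarrow> 'v \<Rightarrow> bool"
  where "maurer_cartan s L l \<alpha> \<longleftrightarrow>
    \<alpha> \<in> L 0 \<and>
    finite {k. 1 \<le> k \<and> l (replicate k \<alpha>) \<noteq> 0} \<and>
    (\<Sum>k | 1 \<le> k \<and> l (replicate k \<alpha>) \<noteq> 0. s (1 / fact k) (l (replicate k \<alpha>))) = 0"

definition twist ::
  "('k::field_char_0 \<Rightarrow> 'v::ab_group_add \<Rightarrow> 'v) \<Rightarrow> ('v list \<Rightarrow> 'v) \<Rightarrow> 'v \<Rightarrow> 'v list \<Rightarrow> 'v"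
  where "twist s l \<alpha> xs =
    (\<Sum>n | l (replicate n \<alpha> @ xs) \<noteq> 0. s (1 / fact n) (l (replicate n \<alpha> @ xs)))"


section \<open>The \<open>L\<^sub>\<infinity>\<close>-structure on \<open>s\<inverse>\<hh> \<oplus> \<aa>\<close>\<close>

text \<open>A pair \<open>(f, h)\<close> of cochains stands for \<open>(s\<inverse>f, h)\<close>.\<close>

definition L_grade ::
  "('k::field \<Rightarrow> 'a::ab_group_add \<Rightarrow> 'a) \<Rightarrow> ('k \<Rightarrow> 'b::ab_group_add \<Rightarrow> 'b) \<Rightarrow> int \<Rightarrow>
   (('a, 'b) cochain \<times> ('a, 'b) cochain) set"
  where "L_grade sA sB d = \<hh>_grade sA sB (d + 1) \<times> \<aa>_grade sA sB d"

definition scaleL ::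
  "('k \<Rightarrow> 'a \<Rightarrow> 'a) \<Rightarrow> ('k \<Rightarrow> 'b \<Rightarrow> 'b) \<Rightarrow> 'k \<Rightarrow>
   ('a, 'b) cochain \<times> ('a, 'b) cochain \<Rightarrow> ('a, 'b) cochain \<times> ('a, 'b) cochain"
  where "scaleL sA sB c X =
    ((\<lambda>T xs. scaleD sA sB c (fst X T xs)), (\<lambda>T xs. scaleD sA sB c (snd X T xs)))"

definition L_component ::
  "int \<Rightarrow> ('a::zero, 'b::zero) cochain \<times> ('a, 'b) cochain \<Rightarrow>
   ('a, 'b) cochain \<times> ('a, 'b) cochain"
  where "L_component d X = (component (d + 1) (fst X), component d (snd X))"

text \<open>
  \<open>L_map_hom ds Xs\<close> is the structure map on homogeneous \<open>Xs\<close> of degrees \<open>ds\<close>, obtained by expanding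
  each argument as \<open>(s\<inverse>f, h) = (s\<inverse>f, 0) + (0, h)\<close>.  In the second component, the \<open>j\<close>-th summand
  takes \<open>s\<inverse>f\<close> from position \<open>j\<close> and \<open>h\<close> from all others; the sign is the Koszul sign of moving
  position \<open>j\<close> to the front.
\<close>

definition L_map_hom ::
  "int list \<Rightarrow> (('a::ab_group_add, 'b::ab_group_add) cochain \<times> ('a, 'b) cochain) list \<Rightarrow>
   ('a, 'b) cochain \<times> ('a, 'b) cochain"
  where "L_map_hom ds Xs =
    ((if length Xs = 2 then signed (ds ! 0 + 1) (bracket (fst (Xs ! 0)) (fst (Xs ! 1))) else 0),
     (if 2 \<le> length Xs then
        (\<Sum>j<length Xs. signed (ds ! j * sum_list (take j ds))
           (proj_\<aa> (foldl bracket (fst (Xs ! j)) (map snd (take j Xs @ drop (Suc j) Xs)))))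
      else 0))"

text \<open>The multilinear extension to the direct sum, summing over the nonzero homogeneous components.\<close>

definition L_map ::
  "(('a::ab_group_add, 'b::ab_group_add) cochain \<times> ('a, 'b) cochain) list \<Rightarrow>
   ('a, 'b) cochain \<times> ('a, 'b) cochain"
  where "L_map Xs =
    (\<Sum>ds \<in> listset (map (\<lambda>X. {d. L_component d X \<noteq> 0}) Xs).
      L_map_hom ds (map2 L_component ds Xs))"

end

(*
  All elements involved have degree 0.  Let X = (f, h) with f in h_1 and h in a_0.  Since h maps B to A
  and vanishes on A, a product of two such maps is zero, and bracketing f with three elements of a_0
  gives 0.  On degree 0 only l_2 and l_3 survive, both symmetric and additive, so the Maurer-Cartan
  expression M(X) = l_2(X,X)/2 + l_3(X,X,X)/6 is a cubic polynomial and the twisted expression at Y is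
  M(X + Y) - M(X) by Taylor expansion.  It remains to see that M(pi, P) = 0 says exactly that the data
  form a relative averaging algebra.  The first component is minus the associator of pi on the eleven
  trees of T_3, i.e. the eleven triassociative axioms on A + B; the weight can be cancelled in those
  involving the perpendicular product.  The second component, on the three trees of T_2, gives the
  three equations for P.
*)
theory Submission
  imports Defs
begin

section \<open>Trees with at most four leaves\<close>

lemma leaves_pos: "reduced T \<Longrightarrow> 1 \<le> leaves T"
proof (induction T)
  case (Node ts)
  then show ?case by (cases ts) fastforce+
qed auto

text \<open>Here the index counts leaves, whereas \<open>trees n\<close> has n + 1 of them. With
  this index, joining a list of trees adds indices, so the enumeration becomes a plain
  recursion.\<close>

definition tree :: "nat \<Rightarrow> ptree \<Rightarrow> bool"
  where "tree n T \<longleftrightarrow> reduced T \<and> leaves T = n"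

text \<open>Unlike the children of a vertex, a forest may have any length, so that the tail of a
  forest is again one.\<close>

definition forest :: "nat \<Rightarrow> ptree list \<Rightarrow> bool"
  where "forest n ts \<longleftrightarrow> (\<forall>t\<in>set ts. reduced t) \<and> sum_list (map leaves ts) = n"

lemma forest_Nil [simp]: "forest n [] \<longleftrightarrow> n = 0"
  by (auto simp: forest_def)

lemma forest_Cons: "forest n (t # ts) \<longleftrightarrow> (\<exists>k\<in>{1..n}. tree k t \<and> forest (n - k) ts)"
  by (auto simp: forest_def tree_def dest: leaves_pos)

lemma forest_0 [simp]: "forest 0 ts \<longleftrightarrow> ts = []"
  by (cases ts) (auto simp: forest_Cons)

lemma forest_iff:
  "forest n ts \<longleftrightarrow>
    ts = [] \<and> n = 0 \<or> (\<exists>t us. ts = t # us \<and> (\<exists>k\<in>{1..n}. tree k t \<and> forest (n - k) us))"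
  by (cases ts) (auto simp: forest_Cons)

text \<open>The strict bound k < n encodes that the root has at least two children: something
  remains after the first child exactly when it does not use all leaves. Trees with n leaves thus
  need only smaller trees and forests, and alternating with \<open>forest_iff\<close> enumerates all
  small cases.\<close>

lemma tree_iff:
  "tree n T \<longleftrightarrow>
    T = Leaf \<and> n = 1 \<or> (\<exists>t ts. T = Node (t # ts) \<and> (\<exists>k\<in>{1..<n}. tree k t \<and> forest (n - k) ts))"
proof (cases T)
  case (Node us)
  have "tree n T \<longleftrightarrow> 2 \<le> length us \<and> forest n us"
    by (auto simp: Node tree_def forest_def)
  also have "\<dots> \<longleftrightarrow> (\<exists>t ts. us = t # ts \<and> ts \<noteq> [] \<and> forest n (t # ts))"
    by (cases us; cases "tl us") auto
  also have "\<dots> \<longleftrightarrow> (\<exists>t ts. us = t # ts \<and> (\<exists>k\<in>{1..<n}. tree k t \<and> forest (n - k) ts))"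
  proof -
    have "ts \<noteq> [] \<and> forest n (t # ts) \<longleftrightarrow> (\<exists>k\<in>{1..<n}. tree k t \<and> forest (n - k) ts)" for t ts
      by (auto simp: forest_Cons[of n] Suc_le_eq)
        (metis diff_is_0_eq forest_0 le_neq_implies_less Suc_le_eq atLeastLessThan_iff)+
    then show ?thesis by blast
  qed
  finally show ?thesis by (simp add: Node)
qed (auto simp: tree_def)

lemma interval_simps:
  "{Suc 0..2} = {1, 2}" "{Suc 0..3} = {1, 2, 3}"
  "{Suc 0..<2} = {1}" "{Suc 0..<3} = {1, 2}" "{Suc 0..<4} = {1, 2, 3}"
  by auto

lemma tree_1: "tree (Suc 0) T \<longleftrightarrow> T = Leaf"
  by (subst tree_iff) auto

lemma forest_1: "forest (Suc 0) ts \<longleftrightarrow> ts = [Leaf]"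
  by (subst forest_iff) (simp add: tree_1)

lemma tree_2: "tree 2 T \<longleftrightarrow> T = T_one"
  by (subst tree_iff) (simp add: interval_simps tree_1 forest_1 T_one_def)

lemma forest_2: "forest 2 ts \<longleftrightarrow> ts \<in> {[Leaf, Leaf], [T_one]}"
  by (subst forest_iff) (auto simp: interval_simps tree_1 forest_1 tree_2)

lemma tree_3: "tree 3 T \<longleftrightarrow> T \<in> {T_left, T_right, T_perp}"
  by (subst tree_iff)
    (auto simp: interval_simps tree_1 forest_1 tree_2 forest_2
      T_one_def T_left_def T_right_def T_perp_def)

lemma forest_3:
  "forest 3 ts \<longleftrightarrow> ts \<in> {[Leaf, Leaf, Leaf], [Leaf, T_one], [T_one, Leaf], [T_left], [T_right], [T_perp]}"
  by (subst forest_iff)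
    (auto simp: interval_simps tree_1 forest_1 tree_2 forest_2 tree_3)

lemma trees_1: "trees (Suc 0) = {T_one}"
  using tree_2 by (auto simp: trees_def tree_def numeral_2_eq_2)

lemma trees_2: "trees 2 = {T_left, T_right, T_perp}"
  using tree_3 by (auto simp: trees_def tree_def)

text \<open>The order of the list is that of the axioms in \<open>R_pairs_trees_3\<close>, so that
  the images under \<open>R_pairs\<close> can be compared entry by entry.\<close>

lemma trees_3:
  "trees 3 = set (map Node
     [[Leaf, T_left], [Leaf, T_right], [Leaf, T_perp], [T_right, Leaf], [T_left, Leaf], [T_perp, Leaf],
      [T_one, T_one], [Leaf, Leaf, T_one], [Leaf, T_one, Leaf], [T_one, Leaf, Leaf],
      [Leaf, Leaf, Leaf, Leaf]])"
proof (rule set_eqI)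
  fix T
  have "T \<in> trees 3 \<longleftrightarrow> tree 4 T" by (simp add: trees_def tree_def)
  then show "T \<in> trees 3 \<longleftrightarrow> T \<in> set (map Node
     [[Leaf, T_left], [Leaf, T_right], [Leaf, T_perp], [T_right, Leaf], [T_left, Leaf], [T_perp, Leaf],
      [T_one, T_one], [Leaf, Leaf, T_one], [Leaf, T_one, Leaf], [T_one, Leaf, Leaf],
      [Leaf, Leaf, Leaf, Leaf]])"
    by (subst (asm) tree_iff)
      (auto simp: interval_simps tree_1 forest_1 tree_2 forest_2 tree_3 forest_3)
qed

section \<open>Pruning of small trees\<close>

lemmas tree_names = T_one_def T_left_def T_right_def T_perp_def

text \<open>Inner arity 1 means that no leaf is deleted for the outer tree and two adjacent leaves
  are kept for the inner one; outer arity 1 exchanges the roles. Brackets of a binary with a unary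
  cochain use only these values.\<close>

lemma R_trees_2:
  assumes "T \<in> trees 2"
  shows "R_outer (Suc 0) (Suc 0) T = T" "R_outer 2 (Suc 0) T = T" "R_inner (Suc 0) (Suc 0) T = T_one"
    "R_inner 2 (Suc 0) T = T_one" "R_outer (Suc 0) 2 T = T_one" "R_inner (Suc 0) 2 T = T"
  using assms by (auto simp: trees_2 tree_names R_outer_def R_inner_def)

text \<open>This is all that the two compositions of binary cochains see of a tree with four
  leaves.\<close>

definition R_pairs :: "ptree \<Rightarrow> ptree \<times> ptree \<times> ptree \<times> ptree"
  where "R_pairs T = (R_outer 1 2 T, R_inner 1 2 T, R_outer 2 2 T, R_inner 2 2 T)"

text \<open>
  An entry \<open>(T, T', S, S')\<close> stands for the identity \<open>(x *\<^sub>T\<^sub>' y) *\<^sub>T z = x *\<^sub>S (y *\<^sub>S\<^sub>' z)\<close>; the eleven entries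
  are the axioms of a triassociative algebra.
\<close>

lemma R_pairs_trees_3:
  "R_pairs ` trees 3 = set
     [(T_left, T_left, T_left, T_left), (T_left, T_left, T_left, T_right),
      (T_left, T_left, T_left, T_perp), (T_right, T_right, T_right, T_right),
      (T_right, T_left, T_right, T_right), (T_right, T_perp, T_right, T_right),
      (T_left, T_right, T_right, T_left), (T_left, T_perp, T_perp, T_left),
      (T_perp, T_left, T_perp, T_right), (T_perp, T_right, T_right, T_perp),
      (T_perp, T_perp, T_perp, T_perp)]"
proof -
  have "R_pairs ` trees 3 = set (map R_pairs (map Node
     [[Leaf, T_left], [Leaf, T_right], [Leaf, T_perp], [T_right, Leaf], [T_left, Leaf], [T_perp, Leaf],
      [T_one, T_one], [Leaf, Leaf, T_one], [Leaf, T_one, Leaf], [T_one, Leaf, Leaf],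
      [Leaf, Leaf, Leaf, Leaf]]))"
    by (simp only: trees_3 set_map)
  also have "map R_pairs (map Node
     [[Leaf, T_left], [Leaf, T_right], [Leaf, T_perp], [T_right, Leaf], [T_left, Leaf], [T_perp, Leaf],
      [T_one, T_one], [Leaf, Leaf, T_one], [Leaf, T_one, Leaf], [T_one, Leaf, Leaf],
      [Leaf, Leaf, Leaf, Leaf]]) =
     [(T_left, T_left, T_left, T_left), (T_left, T_left, T_left, T_right),
      (T_left, T_left, T_left, T_perp), (T_right, T_right, T_right, T_right),
      (T_right, T_left, T_right, T_right), (T_right, T_perp, T_right, T_right),
      (T_left, T_right, T_right, T_left), (T_left, T_perp, T_perp, T_left),
      (T_perp, T_left, T_perp, T_right), (T_perp, T_right, T_right, T_perp),
      (T_perp, T_perp, T_perp, T_perp)]"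
    by (simp add: R_pairs_def tree_names R_outer_def R_inner_def)
  finally show ?thesis .
qed

section \<open>Brackets in low arity\<close>

text \<open>
  The clause about \<open>0 \<in> set xs\<close> is the only part of multilinearity that is needed to see that a bracket
  with \<open>0\<close> vanishes.
\<close>

definition of_arity :: "nat \<Rightarrow> ('a::zero, 'b::zero) cochain \<Rightarrow> bool"
  where "of_arity n f \<longleftrightarrow>
    (\<forall>T xs. T \<notin> trees n \<or> length xs \<noteq> n \<or> 0 \<in> set xs \<longrightarrow> f T xs = 0)"

text \<open>The test in \<open>component\<close> is on leaves: degree d means arity d + 1 and hence
  d + 2 leaves.\<close>

lemma component_of_arity:
  assumes "of_arity n f"
  shows "component d f = (if d + 1 = int n then f else 0)"
  using assms by (auto simp: component_def of_arity_def trees_def fun_eq_iff)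

lemma signed_0 [simp]: "signed e 0 = 0"
  by (simp add: signed_def)

lemma insertion_0_left [simp]: "insertion m i n 0 g = 0"
  by (simp add: insertion_def fun_eq_iff)

lemma insertion_0_right:
  assumes "of_arity m f"
  shows "insertion m i n f 0 = 0"
  using assms by (simp add: insertion_def fun_eq_iff of_arity_def)

lemma signed_apply: "signed e F x = signed e (F x)"
  by (simp add: signed_def)

lemma sum_apply: "(\<Sum>i\<in>I. F i) x = (\<Sum>i\<in>I. F i x)"
  by (induction I rule: infinite_finite_induct) auto

text \<open>A zero argument either lies in the inserted block, where \<open>g\<close> turns it into
  a zero argument of \<open>f\<close>, or is an argument of \<open>f\<close> already.\<close>

lemma of_arity_insertion:
  assumes "of_arity m f" "of_arity n g"
  shows "of_arity (m + n - 1) (insertion m i n f g)"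
proof -
  have zero: "insertion m i n f g T xs = 0" if "0 \<in> set xs" for T xs
  proof -
    have "xs = take (i - 1) xs @ take n (drop (i - 1) xs) @ drop (i - 1 + n) xs"
      by (metis append_take_drop_id drop_drop add.commute)
    then have "set xs = set (take (i - 1) xs) \<union> set (take n (drop (i - 1) xs)) \<union> set (drop (i - 1 + n) xs)"
      by (metis set_append Un_assoc)
    then show ?thesis
      using that assms by (auto simp: insertion_def of_arity_def)
  qed
  have "insertion m i n f g T xs = 0" if "T \<notin> trees (m + n - 1) \<or> length xs \<noteq> m + n - 1" for T xs
    using that by (auto simp: insertion_def)
  with zero show ?thesis unfolding of_arity_def by blast
qed

lemma of_arity_bracket_hom:
  assumes "of_arity m f" "of_arity n g"
  shows "of_arity (m + n - 1) (bracket_hom m n f g)"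
  using of_arity_insertion[OF assms] of_arity_insertion[OF assms(2,1)]
  by (simp add: of_arity_def bracket_hom_def signed_apply sum_apply add.commute)

lemma bracket_hom_0:
  "of_arity m f \<Longrightarrow> bracket_hom m n f 0 = 0" "of_arity n g \<Longrightarrow> bracket_hom m n 0 g = 0"
  by (simp_all add: bracket_hom_def insertion_0_right)

text \<open>Every summand other than (p, q) has a zero component as an argument. If (p, q) itself is
  not summed over, the tree has the wrong number of leaves and the right-hand side is zero
  too.\<close>

lemma bracket_eq_bracket_hom:
  assumes "of_arity p f" "of_arity q g" "1 \<le> p" "1 \<le> q"
  shows "bracket f g = bracket_hom p q f g"
proof (intro ext)
  fix T xs
  let ?I = "{(m, n). 1 \<le> m \<and> 1 \<le> n \<and> m + n = leaves T}"
  have fin: "finite ?I"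
    by (rule finite_subset[of _ "{..leaves T} \<times> {..leaves T}"]) auto
  \<comment> \<open>When both components vanish, \<open>bracket_hom_0\<close> still asks for the
    arity of one of them; zero has every arity.\<close>
  have "of_arity n (0 :: ('a, 'b) cochain)" for n
    by (simp add: of_arity_def)
  note zero = bracket_hom_0(1)[OF this] bracket_hom_0[OF assms(1)] bracket_hom_0(2)[OF assms(2)]
  have "bracket f g T xs = (\<Sum>z\<in>?I. if z = (p, q) then bracket_hom p q f g T xs else 0)"
    unfolding bracket_def
    by (rule sum.cong) (auto simp: zero component_of_arity[OF assms(1)] component_of_arity[OF assms(2)]
        split: if_splits)
  also have "\<dots> = (if (p, q) \<in> ?I then bracket_hom p q f g T xs else 0)"
    using fin by simp
  also have "\<dots> = bracket_hom p q f g T xs"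
    using of_arity_bracket_hom[OF assms(1,2)] assms(3,4) by (auto simp: of_arity_def trees_def)
  finally show "bracket f g T xs = bracket_hom p q f g T xs" .
qed

lemma list_length_2: "length xs = 2 \<Longrightarrow> xs = [xs ! 0, xs ! 1]"
  by (cases xs; cases "tl xs") auto

text \<open>As one arity is 1, all sign exponents vanish: insertions into \<open>f\<close> count
  positively, insertion into \<open>h\<close> negatively.\<close>

lemma bracket_2_1:
  assumes "of_arity 2 f" "of_arity 1 h"
  shows "bracket f h = (\<lambda>T xs. if T \<in> trees 2 \<and> length xs = 2
    then f T [h T_one [xs ! 0], xs ! 1] + f T [xs ! 0, h T_one [xs ! 1]] - h T_one [f T xs]
    else 0)"
proof (intro ext)
  fix T and xs :: "('a \<times> 'b) list"
  show "bracket f h T xs = (if T \<in> trees 2 \<and> length xs = 2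
    then f T [h T_one [xs ! 0], xs ! 1] + f T [xs ! 0, h T_one [xs ! 1]] - h T_one [f T xs]
    else 0)"
  proof (cases "T \<in> trees 2 \<and> length xs = 2")
    case True
    then obtain u v where "xs = [u, v]" using list_length_2 by blast
    with True show ?thesis
      unfolding bracket_eq_bracket_hom[OF assms one_le_numeral le_refl] bracket_hom_def
      by (simp add: signed_def sum_apply insertion_def interval_simps R_trees_2 flip: numeral_2_eq_2)
  next
    case False
    then show ?thesis
      using of_arity_bracket_hom[OF assms] bracket_eq_bracket_hom[OF assms]
      by (auto simp: of_arity_def)
  qed
qed

text \<open>For f = g this is the associator, tree by tree; two arguments are kept because the
  bracket polarises it.\<close>

definition comp_defect :: "('a::ab_group_add, 'b::ab_group_add) cochain \<Rightarrow> ('a, 'b) cochain \<Rightarrow> ('a, 'b) cochain"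
  where "comp_defect f g = (\<lambda>T xs. if T \<in> trees 3 \<and> length xs = 3
    then f (R_outer 1 2 T) [g (R_inner 1 2 T) [xs ! 0, xs ! 1], xs ! 2]
      - f (R_outer 2 2 T) [xs ! 0, g (R_inner 2 2 T) [xs ! 1, xs ! 2]]
    else 0)"

lemma list_length_3: "length xs = 3 \<Longrightarrow> xs = [xs ! 0, xs ! 1, xs ! 2]"
  by (cases xs; cases "tl xs"; cases "tl (tl xs)") auto

lemma insertion_2_2: "insertion 2 1 2 f g - insertion 2 2 2 f g = comp_defect f g"
proof (intro ext)
  fix T and xs :: "('a \<times> 'b) list"
  show "(insertion 2 1 2 f g - insertion 2 2 2 f g) T xs = comp_defect f g T xs"
  proof (cases "length xs = 3")
    case True
    then obtain u v w where "xs = [u, v, w]" using list_length_3 by blast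
    then show ?thesis by (simp add: insertion_def comp_defect_def)
  qed (simp add: insertion_def comp_defect_def)
qed

text \<open>The exponent in front of the second sum is 1, so the subtraction becomes an addition and
  the bracket is symmetric.\<close>

lemma bracket_2_2:
  assumes "of_arity 2 f" "of_arity 2 g"
  shows "bracket f g = comp_defect f g + comp_defect g f"
proof -
  have "bracket f g = insertion 2 1 2 f g - insertion 2 2 2 f g
     + (insertion 2 1 2 g f - insertion 2 2 2 g f)"
    unfolding bracket_eq_bracket_hom[OF assms one_le_numeral one_le_numeral] bracket_hom_def
    by (simp add: signed_def interval_simps)
  then show ?thesis unfolding insertion_2_2 .
qed

section \<open>Evaluation rules for binary elements of h and unary elements of a\<close>

lemma linear_add: "Vector_Spaces.linear s t F \<Longrightarrow> F (x + y) = F x + F y"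
  by (simp add: Vector_Spaces.linear_iff)

lemma linear_0: "Vector_Spaces.linear s t F \<Longrightarrow> F 0 = 0"
  using linear_add[of s t F 0 0] by simp

lemma bilin_add:
  assumes "bilin sU sV sW F"
  shows "F (u + u') v = F u v + F u' v" "F u (v + v') = F u v + F u v'"
  using assms by (auto simp: bilin_def dest: linear_add)

lemma multilinear_1: "multilinear s 1 F \<longleftrightarrow> Vector_Spaces.linear s s (\<lambda>u. F [u])"
  by (auto simp: multilinear_def length_Suc_conv)

lemma multilinear_2: "multilinear s 2 F \<longleftrightarrow> bilin s s s (\<lambda>u v. F [u, v])"
proof
  assume "multilinear s 2 F"
  then have "Vector_Spaces.linear s s (\<lambda>x. F ([u, v][i := x]))" if "i < 2" for u v i
  proof -
    have "length [u, v] = 2" by simp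
    with that \<open>multilinear s 2 F\<close> show ?thesis unfolding multilinear_def by blast
  qed
  from this[of 0] this[of 1] show "bilin s s s (\<lambda>u v. F [u, v])"
    by (simp add: bilin_def)
next
  assume F: "bilin s s s (\<lambda>u v. F [u, v])"
  show "multilinear s 2 F"
    unfolding multilinear_def
  proof (intro allI impI)
    fix xs :: "'b list" and i :: nat
    assume "length xs = 2" "i < 2"
    then obtain u v where "xs = [u, v]" using list_length_2 by blast
    with \<open>i < 2\<close> F show "Vector_Spaces.linear s s (\<lambda>x. F (xs[i := x]))"
      by (cases i) (auto simp: bilin_def)
  qed
qed

lemma of_arity_cochains:
  assumes "f \<in> cochains sA sB n"
  shows "of_arity n f"
proof -
  have "f T xs = 0" if T: "T \<in> trees n" and xs: "length xs = n" "0 \<in> set xs" for T xs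
  proof -
    obtain i where i: "i < n" "xs ! i = 0"
      using xs by (auto simp: in_set_conv_nth)
    have "Vector_Spaces.linear (scaleD sA sB) (scaleD sA sB) (\<lambda>x. f T (xs[i := x]))"
      using assms T xs i by (auto simp: cochains_def multilinear_def)
    from linear_0[OF this] show ?thesis
      using i by (metis list_update_id)
  qed
  then show ?thesis
    using assms unfolding of_arity_def cochains_def by blast
qed

context
  fixes sA :: "'k::field \<Rightarrow> 'a::ab_group_add \<Rightarrow> 'a" and sB :: "'k \<Rightarrow> 'b::ab_group_add \<Rightarrow> 'b"
    and f :: "('a, 'b) cochain"
  assumes f: "f \<in> \<hh>_grade sA sB 1"
begin

lemma hh_cochains: "f \<in> cochains sA sB 2"
  using f by (simp add: \<hh>_grade_def \<gg>_grade_def)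

lemma hh_of_arity: "of_arity 2 f"
  using hh_cochains by (rule of_arity_cochains)

lemma hh_add: "f T [u + u', v] = f T [u, v] + f T [u', v]" "f T [u, v + v'] = f T [u, v] + f T [u, v']"
proof -
  have "f T [u + u', v] = f T [u, v] + f T [u', v] \<and> f T [u, v + v'] = f T [u, v] + f T [u, v']"
  proof (cases "T \<in> trees 2")
    case True
    then have "bilin (scaleD sA sB) (scaleD sA sB) (scaleD sA sB) (\<lambda>u v. f T [u, v])"
      using hh_cochains by (simp add: cochains_def multilinear_2)
    from bilin_add[OF this] show ?thesis by blast
  next
    case False
    then show ?thesis using hh_of_arity by (simp add: of_arity_def)
  qed
  then show "f T [u + u', v] = f T [u, v] + f T [u', v]" "f T [u, v + v'] = f T [u, v] + f T [u, v']"
    by auto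
qed

lemma hh_0: "f T [0, v] = 0" "f T [u, 0] = 0"
  using hh_of_arity by (simp_all add: of_arity_def)

lemma hh_word:
  assumes "\<forall>x\<in>set xs. in_A x \<or> in_B x"
  shows "if \<forall>x\<in>set xs. in_A x then in_A (f T xs) else in_B (f T xs)"
  using f assms by (auto simp: \<hh>_grade_def)

lemma hh_AA: "snd u = 0 \<Longrightarrow> snd v = 0 \<Longrightarrow> snd (f T [u, v]) = 0"
  using hh_word[of "[u, v]" T] by (auto simp: in_A_def)

text \<open>So B is an ideal for \<open>f\<close>. The grading condition speaks only of words in A
  and B; a general second argument is split into its two parts.\<close>

lemma hh_B_left: "fst u = 0 \<Longrightarrow> fst (f T [u, v]) = 0"
proof -
  assume u: "fst u = 0"
  have "fst (f T [u, w]) = 0" if "in_A w \<or> in_B w" for w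
  \<comment> \<open>Zero lies in both A and B, so the word condition could fall into the branch with
    values in A.\<close>
  proof (cases "u = 0")
    case False
    with u have "\<not> in_A u" by (simp add: in_A_def prod_eq_iff)
    with that u show ?thesis using hh_word[of "[u, w]" T] by (auto simp: in_B_def split: if_splits)
  qed (simp add: hh_0)
  moreover have "v = (fst v, 0) + (0, snd v)" by (simp add: prod_eq_iff)
  ultimately show ?thesis
    using hh_add(2)[of T u "(fst v, 0)" "(0, snd v)"] by (simp add: in_A_def in_B_def)
qed

lemma hh_B_right: "fst v = 0 \<Longrightarrow> fst (f T [u, v]) = 0"
proof -
  assume v: "fst v = 0"
  have "fst (f T [w, v]) = 0" if "in_A w \<or> in_B w" for w
  proof (cases "v = 0")
    case False
    with v have "\<not> in_A v" by (simp add: in_A_def prod_eq_iff)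
    with that v show ?thesis using hh_word[of "[w, v]" T] by (auto simp: in_B_def split: if_splits)
  qed (simp add: hh_0)
  moreover have "u = (fst u, 0) + (0, snd u)" by (simp add: prod_eq_iff)
  ultimately show ?thesis
    using hh_add(1)[of T "(fst u, 0)" "(0, snd u)" v] by (simp add: in_A_def in_B_def)
qed

end

context
  fixes sA :: "'k::field \<Rightarrow> 'a::ab_group_add \<Rightarrow> 'a" and sB :: "'k \<Rightarrow> 'b::ab_group_add \<Rightarrow> 'b"
    and h :: "('a, 'b) cochain"
  assumes h: "h \<in> \<aa>_grade sA sB 0"
begin

lemma aa_cochains: "h \<in> cochains sA sB 1"
  using h by (simp add: \<aa>_grade_def \<gg>_grade_def)

lemma aa_of_arity: "of_arity 1 h"
  using aa_cochains by (rule of_arity_cochains)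

lemma aa_add: "h T [u + v] = h T [u] + h T [v]"
proof (cases "T \<in> trees 1")
  case True
  then have "Vector_Spaces.linear (scaleD sA sB) (scaleD sA sB) (\<lambda>u. h T [u])"
    using aa_cochains unfolding cochains_def multilinear_1 by blast
  from linear_add[OF this] show ?thesis .
next
  case False
  then show ?thesis using aa_of_arity by (simp add: of_arity_def)
qed

lemma aa_0: "h T [0] = 0"
  using aa_of_arity by (simp add: of_arity_def)

lemma aa_word:
  assumes "\<forall>x\<in>set xs. in_A x \<or> in_B x"
  shows "if \<forall>x\<in>set xs. in_B x then in_A (h T xs) else h T xs = 0"
  using h assms by (auto simp: \<aa>_grade_def)

lemma aa_A: "snd u = 0 \<Longrightarrow> h T [u] = 0"
proof (cases "u = 0")
  case False
  assume "snd u = 0"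
  with False show ?thesis
    using aa_word[of "[u]" T] by (auto simp: in_A_def in_B_def prod_eq_iff split: if_splits)
qed (simp add: aa_0)

text \<open>The A-part of the argument is a word containing A, on which \<open>h\<close>
  vanishes.\<close>

lemma aa_snd_arg: "h T [u] = h T [(0, snd u)]"
proof -
  have "u = (fst u, 0) + (0, snd u)" by (simp add: prod_eq_iff)
  then show ?thesis using aa_add[of T "(fst u, 0)" "(0, snd u)"] aa_A[of "(fst u, 0)" T] by simp
qed

lemma aa_snd: "snd (h T [u]) = 0"
  using aa_word[of "[(0, snd u)]" T] by (subst aa_snd_arg) (simp add: in_A_def in_B_def)

lemma aa_diff: "h T [u - v] = h T [u] - h T [v]"
  using aa_add[of T "u - v" v] by (simp add: algebra_simps)

end

section \<open>Iterated brackets with elements of a and their projections\<close>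

definition out_term :: "('a::ab_group_add, 'b::ab_group_add) cochain \<Rightarrow> ('a, 'b) cochain \<Rightarrow> ('a, 'b) cochain"
  where "out_term f h = (\<lambda>T xs. if T \<in> trees 2 \<and> length xs = 2
    then h T_one [f T [(0, snd (xs ! 0)), (0, snd (xs ! 1))]] else 0)"

text \<open>Polarised form of the averaging identity: for h = k it compares the product of two
  values of \<open>h\<close> with the value of \<open>h\<close> on the two mixed products.\<close>

definition avg_term :: "('a::ab_group_add, 'b::ab_group_add) cochain \<Rightarrow> ('a, 'b) cochain \<Rightarrow> ('a, 'b) cochain \<Rightarrow> ('a, 'b) cochain"
  where "avg_term f h k = (\<lambda>T xs. if T \<in> trees 2 \<and> length xs = 2
    then f T [h T_one [xs ! 0], k T_one [xs ! 1]]
      - h T_one [f T [k T_one [xs ! 0], xs ! 1] + f T [xs ! 0, k T_one [xs ! 1]]]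
    else 0)"

lemma of_arity_bracket_2_1:
  assumes "of_arity 2 f" "of_arity 1 h"
  shows "of_arity 2 (bracket f h)"
  using of_arity_bracket_hom[OF assms] bracket_eq_bracket_hom[OF assms] by simp

text \<open>On inputs from B, the terms f(h u, v) and f(u, h v) lie in B by the ideal property and
  are killed by the projection; only the term with \<open>h\<close> outside survives.\<close>

lemma proj_bracket_1:
  assumes f: "f \<in> \<hh>_grade sA sB 1" and h: "h \<in> \<aa>_grade sA sB 0"
  shows "proj_\<aa> (bracket f h) = - out_term f h"
proof (intro ext)
  fix T xs
  have "fst (f T [u, v]) = 0" if "fst u = 0 \<or> fst v = 0" for u v
    using that hh_B_left[OF f] hh_B_right[OF f] by blast
  then show "proj_\<aa> (bracket f h) T xs = (- out_term f h) T xs"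
    by (cases xs rule: list.exhaust; cases "tl xs")
      (auto simp: proj_\<aa>_def out_term_def bracket_2_1[OF hh_of_arity[OF f] aa_of_arity[OF h]]
        prod_eq_iff aa_snd[OF h] zero_prod_def)
qed

text \<open>Of the nine terms, the three composing \<open>h\<close> and \<open>k\<close> directly
  vanish, since values in A are killed. The other six split according to whether \<open>h\<close> or
  \<open>k\<close> is applied last or in the first slot.\<close>

lemma bracket_bracket:
  assumes f: "f \<in> \<hh>_grade sA sB 1" and h: "h \<in> \<aa>_grade sA sB 0" and k: "k \<in> \<aa>_grade sA sB 0"
  shows "bracket (bracket f h) k = avg_term f h k + avg_term f k h"
proof (intro ext)
  fix T xs
  have ar: "of_arity 2 (bracket f h)"
    using of_arity_bracket_2_1[OF hh_of_arity[OF f] aa_of_arity[OF h]] .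
  show "bracket (bracket f h) k T xs = (avg_term f h k + avg_term f k h) T xs"
  proof (cases "T \<in> trees 2 \<and> length xs = 2")
    case True
    have kh: "h T' [k T'' [u]] = 0" "k T' [h T'' [u]] = 0" for T' T'' u
      using aa_A[OF h] aa_A[OF k] aa_snd[OF h] aa_snd[OF k] by auto
    from True show ?thesis
      unfolding bracket_2_1[OF ar aa_of_arity[OF k]]
      by (simp add: bracket_2_1[OF hh_of_arity[OF f] aa_of_arity[OF h]] avg_term_def kh hh_0[OF f]
        aa_add[OF k] aa_add[OF h] aa_diff[OF k] algebra_simps list_length_2[symmetric])
  next
    case False
    then show ?thesis
      unfolding bracket_2_1[OF ar aa_of_arity[OF k]] by (auto simp: avg_term_def)
  qed
qed

text \<open>The double bracket takes values in A, which \<open>q\<close> kills, and vanishes when an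
  argument lies in A, as all values of \<open>q\<close> do.\<close>

lemma bracket_bracket_bracket:
  assumes f: "f \<in> \<hh>_grade sA sB 1" and h: "h \<in> \<aa>_grade sA sB 0"
    and k: "k \<in> \<aa>_grade sA sB 0" and q: "q \<in> \<aa>_grade sA sB 0"
  shows "bracket (bracket (bracket f h) k) q = 0"
proof (intro ext)
  fix T xs
  have ar: "of_arity 2 (bracket (bracket f h) k)"
    using of_arity_bracket_2_1[OF of_arity_bracket_2_1[OF hh_of_arity[OF f] aa_of_arity[OF h]] aa_of_arity[OF k]] .
  have aa: "h T' [u] = 0 \<and> k T' [u] = 0 \<and> q T' [u] = 0" if "snd u = 0" for T' u
    using that aa_A[OF h] aa_A[OF k] aa_A[OF q] by auto
  show "bracket (bracket (bracket f h) k) q T xs = 0 T xs"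
    unfolding bracket_2_1[OF ar aa_of_arity[OF q]]
    unfolding bracket_bracket[OF f h k]
    by (auto simp: avg_term_def aa aa_snd[OF h] aa_snd[OF k] aa_snd[OF q] aa_add[OF h] aa_add[OF k]
       hh_0[OF f] hh_AA[OF f])
qed

text \<open>The A-part of an argument contributes only \<open>h\<close> of a product of two elements
  of A, which is zero; hence restricting to B loses nothing.\<close>

lemma proj_avg_term:
  assumes f: "f \<in> \<hh>_grade sA sB 1" and h: "h \<in> \<aa>_grade sA sB 0" and k: "k \<in> \<aa>_grade sA sB 0"
  shows "proj_\<aa> (avg_term f h k) = avg_term f h k"
proof (intro ext)
  fix T xs
  have 1: "h T' [f T [k T'' [u], v]] = h T' [f T [k T'' [u], (0, snd v)]]" for T' T'' u v
  proof -
    have "f T [k T'' [u], v] = f T [k T'' [u], (fst v, 0)] + f T [k T'' [u], (0, snd v)]"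
      using hh_add(2)[OF f, of T "k T'' [u]" "(fst v, 0)" "(0, snd v)"] by simp
    then show ?thesis
      using aa_A[OF h, of "f T [k T'' [u], (fst v, 0)]" T'] hh_AA[OF f, of "k T'' [u]" "(fst v, 0)" T]
      by (simp add: aa_add[OF h] aa_snd[OF k])
  qed
  have 2: "h T' [f T [v, k T'' [u]]] = h T' [f T [(0, snd v), k T'' [u]]]" for T' T'' u v
  proof -
    have "f T [v, k T'' [u]] = f T [(fst v, 0), k T'' [u]] + f T [(0, snd v), k T'' [u]]"
      using hh_add(1)[OF f, of T "(fst v, 0)" "(0, snd v)" "k T'' [u]"] by simp
    then show ?thesis
      using aa_A[OF h, of "f T [(fst v, 0), k T'' [u]]" T'] hh_AA[OF f, of "(fst v, 0)" "k T'' [u]" T]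
      by (simp add: aa_add[OF h] aa_snd[OF k])
  qed
  show "proj_\<aa> (avg_term f h k) T xs = avg_term f h k T xs"
  proof (cases "T \<in> trees 2 \<and> length xs = 2")
    case True
    then obtain u v where xs: "xs = [u, v]" using list_length_2 by blast
    have "avg_term f h k T [(0, snd u), (0, snd v)] = avg_term f h k T [u, v]"
      unfolding avg_term_def
      using 1[of T_one T_one u v] 2[of T_one u T_one v] aa_snd_arg[OF h, of T_one u] aa_snd_arg[OF k, of T_one u]
       aa_snd_arg[OF h, of T_one v] aa_snd_arg[OF k, of T_one v]
      by (simp add: aa_add[OF h])
    moreover have "snd (avg_term f h k T [u, v]) = 0"
      by (simp add: avg_term_def hh_AA[OF f] aa_snd[OF h] aa_snd[OF k])
    ultimately show ?thesis by (simp add: proj_\<aa>_def xs prod_eq_iff)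
  qed (auto simp: proj_\<aa>_def avg_term_def zero_prod_def)
qed

lemma proj_add: "proj_\<aa> (f + g) = proj_\<aa> f + proj_\<aa> g" for f g :: "('a::ab_group_add, 'b::ab_group_add) cochain"
  by (simp add: proj_\<aa>_def fun_eq_iff)

section \<open>The structure maps in degree 0\<close>

lemma foldl_bracket_eq_0:
  assumes f: "f \<in> \<hh>_grade sA sB 1" and hs: "set hs \<subseteq> \<aa>_grade sA sB 0" and len: "3 \<le> length hs"
  shows "foldl bracket f hs = 0"
proof -
  obtain h k q gs where eq: "hs = h # k # q # gs"
    using len by (metis Suc_le_length_iff numeral_3_eq_3)
  have zero: "bracket 0 g = 0" if "g \<in> \<aa>_grade sA sB 0" for g
    using bracket_eq_bracket_hom[of 2 0 1 g] bracket_hom_0(2)[of 1 g 2] aa_of_arity[OF that]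
    by (simp add: of_arity_def)
  have "foldl bracket 0 gs = 0" if "set gs \<subseteq> \<aa>_grade sA sB 0" for gs
    using that by (induction gs) (auto simp: zero)
  then show ?thesis
    using hs by (simp add: eq bracket_bracket_bracket[OF f])
qed

text \<open>Closed form of l_2 in degree 0. The first minus sign is (-1)^|f| with |f| = 1, the
  second comes from \<open>proj_bracket_1\<close>.\<close>

definition L_two ::
  "('a::ab_group_add, 'b::ab_group_add) cochain \<times> ('a, 'b) cochain \<Rightarrow> ('a, 'b) cochain \<times> ('a, 'b) cochain
    \<Rightarrow> ('a, 'b) cochain \<times> ('a, 'b) cochain" where
  "L_two X Y = (- (comp_defect (fst X) (fst Y) + comp_defect (fst Y) (fst X)),
    - (out_term (fst X) (snd Y) + out_term (fst Y) (snd X)))"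

text \<open>One bracketed pair for each position that supplies the element of h.\<close>

definition L_three ::
  "('a::ab_group_add, 'b::ab_group_add) cochain \<times> ('a, 'b) cochain \<Rightarrow> ('a, 'b) cochain \<times> ('a, 'b) cochain
    \<Rightarrow> ('a, 'b) cochain \<times> ('a, 'b) cochain \<Rightarrow> ('a, 'b) cochain \<times> ('a, 'b) cochain" where
  "L_three X Y Z = (0,
    avg_term (fst X) (snd Y) (snd Z) + avg_term (fst X) (snd Z) (snd Y) +
    (avg_term (fst Y) (snd X) (snd Z) + avg_term (fst Y) (snd Z) (snd X)) +
    (avg_term (fst Z) (snd X) (snd Y) + avg_term (fst Z) (snd Y) (snd X)))"

context
  fixes sA :: "'k::field \<Rightarrow> 'a::ab_group_add \<Rightarrow> 'a" and sB :: "'k \<Rightarrow> 'b::ab_group_add \<Rightarrow> 'b"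
begin

lemma L_component_grade_0:
  assumes "X \<in> L_grade sA sB 0"
  shows "L_component d X = (if d = 0 then X else 0)"
proof -
  have "of_arity 2 (fst X)" "of_arity 1 (snd X)"
    using assms hh_of_arity aa_of_arity by (auto simp: L_grade_def)
  then show ?thesis
    by (simp add: L_component_def component_of_arity prod_eq_iff)
qed

lemma listset_degrees:
  assumes "set Xs \<subseteq> L_grade sA sB 0"
  shows "listset (map (\<lambda>X. {d. L_component d X \<noteq> 0}) Xs) =
    (if 0 \<in> set Xs then {} else {replicate (length Xs) 0})"
  using assms
proof (induction Xs)
  case (Cons X Xs)
  then have "{d. L_component d X \<noteq> 0} = (if X = 0 then {} else {0})"
    by (auto simp: L_component_grade_0)
  with Cons show ?case by (auto simp: set_Cons_def)
qed simp

lemma map2_L_component: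
  assumes "set Xs \<subseteq> L_grade sA sB 0"
  shows "map2 L_component (replicate (length Xs) 0) Xs = Xs"
  using assms by (induction Xs) (auto simp: L_component_grade_0)

lemma L_map_grade_0:
  assumes "set Xs \<subseteq> L_grade sA sB 0"
  shows "L_map Xs = (if 0 \<in> set Xs then 0 else L_map_hom (replicate (length Xs) 0) Xs)"
  using assms by (simp add: L_map_def listset_degrees map2_L_component)

lemma L_map_hom_degree_0:
  "L_map_hom (replicate (length Xs) 0) Xs =
    (if length Xs = 2 then - bracket (fst (Xs ! 0)) (fst (Xs ! 1)) else 0,
     if 2 \<le> length Xs then
       \<Sum>j<length Xs. proj_\<aa> (foldl bracket (fst (Xs ! j)) (map snd (take j Xs @ drop (Suc j) Xs)))
     else 0)"
  by (simp add: L_map_hom_def signed_def)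

text \<open>Lengths 0 and 1 vanish by definition of \<open>L_map_hom\<close>; from length 4 on, each
  summand contains at least three brackets with elements of a.\<close>

lemma L_map_eq_0:
  assumes Xs: "set Xs \<subseteq> L_grade sA sB 0" and len: "length Xs \<noteq> 2" "length Xs \<noteq> 3"
  shows "L_map Xs = 0"
proof -
  have "foldl bracket (fst (Xs ! j)) (map snd (take j Xs @ drop (Suc j) Xs)) = 0"
    if "j < length Xs" "2 \<le> length Xs" for j
  proof (rule foldl_bracket_eq_0)
    show "fst (Xs ! j) \<in> \<hh>_grade sA sB 1"
      using subsetD[OF Xs nth_mem[OF that(1)]] by (auto simp: L_grade_def)
    show "set (map snd (take j Xs @ drop (Suc j) Xs)) \<subseteq> \<aa>_grade sA sB 0"
      using Xs by (fastforce simp: L_grade_def dest: in_set_takeD in_set_dropD)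
    show "3 \<le> length (map snd (take j Xs @ drop (Suc j) Xs))"
      using that len by simp
  qed
  moreover have "proj_\<aa> 0 = (0 :: ('a, 'b) cochain)"
    by (simp add: proj_\<aa>_def fun_eq_iff zero_prod_def)
  ultimately have "L_map_hom (replicate (length Xs) 0) Xs = 0"
    unfolding L_map_hom_degree_0 using len by (simp add: zero_prod_def)
  then show ?thesis using L_map_grade_0[OF Xs] by simp
qed

text \<open>
  As \<^const>\<open>L_map\<close> sums over nonzero components, it is an empty sum when some argument is \<open>0\<close>; the formulas
  for \<open>l\<^sub>2\<close> and \<open>l\<^sub>3\<close> have to vanish in that case.
\<close>

lemma L_two_0:
  assumes "X \<in> L_grade sA sB 0"
  shows "L_two 0 X = 0" "L_two X 0 = 0"
  using assms by (auto simp: L_two_def L_grade_def comp_defect_def out_term_def fun_eq_iff hh_0 aa_0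
      zero_prod_def[symmetric] prod_eq_iff)

lemma L_map_2:
  assumes X: "X \<in> L_grade sA sB 0" and Y: "Y \<in> L_grade sA sB 0"
  shows "L_map [X, Y] = L_two X Y"
proof (cases "X = 0 \<or> Y = 0")
  case True
  then show ?thesis using L_map_grade_0[of "[X, Y]"] X Y by (auto simp: L_two_0)
next
  case False
  have f: "fst X \<in> \<hh>_grade sA sB 1" "fst Y \<in> \<hh>_grade sA sB 1"
    and h: "snd X \<in> \<aa>_grade sA sB 0" "snd Y \<in> \<aa>_grade sA sB 0"
    using X Y by (auto simp: L_grade_def)
  have "L_map [X, Y] = L_map_hom (replicate (length [X, Y]) 0) [X, Y]"
    using L_map_grade_0[of "[X, Y]"] X Y False by auto
  also have "\<dots> = L_two X Y"
    unfolding L_map_hom_degree_0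
    by (simp add: lessThan_Suc L_two_def bracket_2_2[OF f[THEN hh_of_arity]]
        proj_bracket_1[OF f(1) h(2)] proj_bracket_1[OF f(2) h(1)] numeral_2_eq_2)
  finally show ?thesis .
qed

lemma L_three_0:
  assumes "X \<in> L_grade sA sB 0" "Y \<in> L_grade sA sB 0"
  shows "L_three 0 X Y = 0" "L_three X 0 Y = 0" "L_three X Y 0 = 0"
  using assms by (auto simp: L_three_def L_grade_def avg_term_def fun_eq_iff hh_0 aa_0
      zero_prod_def[symmetric] prod_eq_iff)

lemma L_map_3:
  assumes X: "X \<in> L_grade sA sB 0" and Y: "Y \<in> L_grade sA sB 0" and Z: "Z \<in> L_grade sA sB 0"
  shows "L_map [X, Y, Z] = L_three X Y Z"
proof (cases "X = 0 \<or> Y = 0 \<or> Z = 0")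
  case True
  then show ?thesis using L_map_grade_0[of "[X, Y, Z]"] X Y Z by (auto simp: L_three_0)
next
  case False
  have f: "fst X \<in> \<hh>_grade sA sB 1" "fst Y \<in> \<hh>_grade sA sB 1" "fst Z \<in> \<hh>_grade sA sB 1"
    and h: "snd X \<in> \<aa>_grade sA sB 0" "snd Y \<in> \<aa>_grade sA sB 0" "snd Z \<in> \<aa>_grade sA sB 0"
    using X Y Z by (auto simp: L_grade_def)
  have "L_map [X, Y, Z] = L_map_hom (replicate (length [X, Y, Z]) 0) [X, Y, Z]"
    using L_map_grade_0[of "[X, Y, Z]"] X Y Z False by auto
  also have "\<dots> = L_three X Y Z"
    unfolding L_map_hom_degree_0
    by (simp add: lessThan_Suc L_three_def bracket_bracket[OF f(1) h(2,3)] bracket_bracket[OF f(2) h(1,3)]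
        bracket_bracket[OF f(3) h(1,2)] proj_add
        proj_avg_term[OF f(1) h(2,3)] proj_avg_term[OF f(2) h(1,3)] proj_avg_term[OF f(3) h(1,2)]
        proj_avg_term[OF f(1) h(3,2)] proj_avg_term[OF f(2) h(3,1)] proj_avg_term[OF f(3) h(2,1)]
        add_ac)
  finally show ?thesis .
qed

lemma L_two_commute: "L_two X Y = L_two Y X"
  by (simp add: L_two_def add.commute)

lemma L_three_commute: "L_three X Y Z = L_three Y X Z" "L_three X Y Z = L_three X Z Y"
  by (simp_all add: L_three_def add_ac)

lemma L_two_add:
  assumes "X \<in> L_grade sA sB 0" "X' \<in> L_grade sA sB 0" "Y \<in> L_grade sA sB 0"
  shows "L_two (X + X') Y = L_two X Y + L_two X' Y"
  using assms
  by (auto simp: L_two_def L_grade_def comp_defect_def out_term_def fun_eq_iff hh_add aa_add)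

lemma L_three_add:
  assumes "X \<in> L_grade sA sB 0" "X' \<in> L_grade sA sB 0" "Y \<in> L_grade sA sB 0" "Z \<in> L_grade sA sB 0"
  shows "L_three (X + X') Y Z = L_three X Y Z + L_three X' Y Z"
  using assms
  by (auto simp: L_three_def L_grade_def avg_term_def fun_eq_iff hh_add aa_add)

end

section \<open>Maurer-Cartan equations of structures with only binary and ternary maps\<close>

lemma vector_space_scaleL:
  assumes "vector_space sA" "vector_space sB"
  shows "vector_space (scaleL sA sB)"
proof -
  interpret A: vector_space sA by fact
  interpret B: vector_space sB by fact
  show ?thesis
    by unfold_locales
      (auto simp: scaleL_def scaleD_def prod_eq_iff fun_eq_iff A.scale_right_distrib B.scale_right_distrib
       A.scale_left_distrib B.scale_left_distrib)
qed

lemma maurer_cartan_cubic: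
  assumes s: "vector_space s" and \<alpha>: "\<alpha> \<in> L 0"
    and l: "\<And>k. k \<noteq> 2 \<Longrightarrow> k \<noteq> 3 \<Longrightarrow> l (replicate k \<alpha>) = 0"
  shows "maurer_cartan s L l \<alpha> \<longleftrightarrow> s (1 / 2) (l [\<alpha>, \<alpha>]) + s (1 / 6) (l [\<alpha>, \<alpha>, \<alpha>]) = 0"
proof -
  interpret vector_space s by fact
  let ?K = "{k. 1 \<le> k \<and> l (replicate k \<alpha>) \<noteq> 0}"
  have sub: "?K \<subseteq> {2, 3}" using l by blast
  then have "(\<Sum>k\<in>?K. s (1 / fact k) (l (replicate k \<alpha>))) = (\<Sum>k\<in>{2,3}. s (1 / fact k) (l (replicate k \<alpha>)))"
    by (intro sum.mono_neutral_left) auto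
  then show ?thesis
    using finite_subset[OF sub] \<alpha> by (simp add: maurer_cartan_def numeral_3_eq_3 numeral_2_eq_2 fact_numeral)
qed

text \<open>Taylor expansion at \<alpha>. The forms \<open>l2\<close> and \<open>l3\<close> are
  symmetric everywhere but agree with \<open>l\<close> only on \<open>L 0\<close>; and
  \<open>L 0\<close> is merely a set here, hence the assumption on \<alpha> + \<beta>.\<close>

lemma maurer_cartan_twist_cubic:
  assumes s: "vector_space s"
    and vanish: "\<And>xs. set xs \<subseteq> L 0 \<Longrightarrow> length xs \<noteq> 2 \<Longrightarrow> length xs \<noteq> 3 \<Longrightarrow> l xs = 0"
    and l2: "\<And>x y. x \<in> L 0 \<Longrightarrow> y \<in> L 0 \<Longrightarrow> l [x, y] = l2 x y"
    and l3: "\<And>x y z. x \<in> L 0 \<Longrightarrow> y \<in> L 0 \<Longrightarrow> z \<in> L 0 \<Longrightarrow> l [x, y, z] = l3 x y z"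
    and comm: "\<And>x y. l2 x y = l2 y x" "\<And>x y z. l3 x y z = l3 y x z" "\<And>x y z. l3 x y z = l3 x z y"
    and add2: "\<And>x x' y. x \<in> L 0 \<Longrightarrow> x' \<in> L 0 \<Longrightarrow> y \<in> L 0 \<Longrightarrow> l2 (x + x') y = l2 x y + l2 x' y"
    and add3: "\<And>x x' y z. x \<in> L 0 \<Longrightarrow> x' \<in> L 0 \<Longrightarrow> y \<in> L 0 \<Longrightarrow> z \<in> L 0 \<Longrightarrow>
      l3 (x + x') y z = l3 x y z + l3 x' y z"
    and \<alpha>: "\<alpha> \<in> L 0" and \<beta>: "\<beta> \<in> L 0" and \<alpha>\<beta>: "\<alpha> + \<beta> \<in> L 0"
    and mc: "maurer_cartan s L l \<alpha>"
  shows "maurer_cartan s L (twist s l \<alpha>) \<beta> \<longleftrightarrow> maurer_cartan s L l (\<alpha> + \<beta>)"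
proof -
  interpret vector_space s by fact
  let ?t = "\<lambda>k. twist s l \<alpha> (replicate k \<beta>)"
  \<comment> \<open>A range independent of k suffices, since more than three copies of \<alpha> give
    a list that is too long.\<close>
  have twist: "?t k = (\<Sum>n\<le>3. s (1 / fact n) (l (replicate n \<alpha> @ replicate k \<beta>)))" for k
    unfolding twist_def
  proof (intro sum.mono_neutral_left)
    show "{n. l (replicate n \<alpha> @ replicate k \<beta>) \<noteq> 0} \<subseteq> {..3}"
    proof
      fix n assume n: "n \<in> {n. l (replicate n \<alpha> @ replicate k \<beta>) \<noteq> 0}"
      have "set (replicate n \<alpha> @ replicate k \<beta>) \<subseteq> L 0"
        using \<alpha> \<beta> by (auto simp: set_replicate_conv_if)
      from vanish[OF this] n show "n \<in> {..3}" by fastforce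
    qed
  qed auto
  have t1: "?t 1 = l2 \<alpha> \<beta> + s (1 / 2) (l3 \<alpha> \<alpha> \<beta>)"
    and t2: "?t 2 = l2 \<beta> \<beta> + l3 \<alpha> \<beta> \<beta>"
    and t3: "?t 3 = l3 \<beta> \<beta> \<beta>"
    unfolding twist using \<alpha> \<beta>
    by (simp_all add: numeral_3_eq_3 numeral_2_eq_2 vanish l2 l3)
  have t0: "?t k = 0" if "3 < k" for k
    unfolding twist using that \<alpha> \<beta>
    by (intro sum.neutral) (auto simp: vanish set_replicate_conv_if)
  let ?K = "{k. 1 \<le> k \<and> ?t k \<noteq> 0}"
  have sub: "?K \<subseteq> {1, 2, 3}"
  proof
    fix k assume "k \<in> ?K"
    then have "1 \<le> k" "\<not> 3 < k" using t0 by auto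
    then show "k \<in> {1, 2, 3}" by auto
  qed
  then have "(\<Sum>k\<in>?K. s (1 / fact k) (?t k)) = (\<Sum>k\<in>{1,2,3}. s (1 / fact k) (?t k))"
    by (intro sum.mono_neutral_left) auto
  also have "\<dots> = l2 \<alpha> \<beta> + s (1 / 2) (l3 \<alpha> \<alpha> \<beta>) + s (1 / 2) (l2 \<beta> \<beta>) + s (1 / 2) (l3 \<alpha> \<beta> \<beta>)
     + s (1 / 6) (l3 \<beta> \<beta> \<beta>)"
    by (simp add: t1[simplified] t2 t3 fact_numeral scale_right_distrib add_ac)
  finally have tw: "maurer_cartan s L (twist s l \<alpha>) \<beta> \<longleftrightarrow>
     l2 \<alpha> \<beta> + s (1 / 2) (l3 \<alpha> \<alpha> \<beta>) + s (1 / 2) (l2 \<beta> \<beta>) + s (1 / 2) (l3 \<alpha> \<beta> \<beta>)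
     + s (1 / 6) (l3 \<beta> \<beta> \<beta>) = 0"
    using finite_subset[OF sub] \<beta> by (simp add: maurer_cartan_def)
  have mc_iff: "maurer_cartan s L l \<gamma> \<longleftrightarrow> s (1 / 2) (l2 \<gamma> \<gamma>) + s (1 / 6) (l3 \<gamma> \<gamma> \<gamma>) = 0"
    if "\<gamma> \<in> L 0" for \<gamma>
    using maurer_cartan_cubic[OF s, of \<gamma> L l] that
    by (simp add: vanish set_replicate_conv_if l2 l3)
  \<comment> \<open>The multiplicities 2 and 3 of mixed terms in the expansion are absorbed into the
    factors 1/2 and 1/6.\<close>
  have double: "s (1 / 2) (x + x) = x" and triple: "s (1 / 6) (x + x + x) = s (1 / 2) x" for x
  proof -
    have "s (1 / 2) (x + x) = s (1 / 2 + 1 / 2) x"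
      by (simp only: scale_left_distrib scale_right_distrib)
    then show "s (1 / 2) (x + x) = x" by simp
    have "s (1 / 6) (x + x + x) = s (1 / 6 + 1 / 6 + 1 / 6) x"
      by (simp only: scale_left_distrib scale_right_distrib)
    then show "s (1 / 6) (x + x + x) = s (1 / 2) x" by simp
  qed
  have "l2 (\<alpha> + \<beta>) (\<alpha> + \<beta>) = l2 \<alpha> \<alpha> + (l2 \<alpha> \<beta> + l2 \<alpha> \<beta>) + l2 \<beta> \<beta>"
    unfolding add2[OF \<alpha> \<beta> \<alpha>\<beta>] comm(1)[of \<alpha> "\<alpha> + \<beta>"] comm(1)[of \<beta> "\<alpha> + \<beta>"]
    by (simp add: add2 \<alpha> \<beta> comm(1)[of \<beta> \<alpha>] add_ac)
  then have q: "s (1 / 2) (l2 (\<alpha> + \<beta>) (\<alpha> + \<beta>)) = s (1 / 2) (l2 \<alpha> \<alpha>) + l2 \<alpha> \<beta> + s (1 / 2) (l2 \<beta> \<beta>)"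
    by (simp only: scale_right_distrib[of _ "_ + _" "l2 \<beta> \<beta>"] scale_right_distrib[of _ "l2 \<alpha> \<alpha>"] double)
  have rot: "l3 x y z = l3 z x y" for x y z
    by (rule trans[OF comm(3) comm(2)])
  have c1: "l3 x y (\<alpha> + \<beta>) = l3 \<alpha> x y + l3 \<beta> x y" if "x \<in> L 0" "y \<in> L 0" for x y
    unfolding rot[of x y] by (rule add3[OF \<alpha> \<beta> that])
  have c2: "l3 x (\<alpha> + \<beta>) y = l3 \<alpha> x y + l3 \<beta> x y" if "x \<in> L 0" "y \<in> L 0" for x y
    unfolding comm(2)[of x] by (rule add3[OF \<alpha> \<beta> that])
  have c3: "l3 \<beta> \<alpha> \<alpha> = l3 \<alpha> \<alpha> \<beta>" "l3 \<alpha> \<beta> \<alpha> = l3 \<alpha> \<alpha> \<beta>" "l3 \<beta> \<alpha> \<beta> = l3 \<alpha> \<beta> \<beta>" "l3 \<beta> \<beta> \<alpha> = l3 \<alpha> \<beta> \<beta>"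
    by (rule rot[symmetric] rot comm)+
  have "l3 (\<alpha> + \<beta>) (\<alpha> + \<beta>) (\<alpha> + \<beta>) = l3 \<alpha> \<alpha> \<alpha> + (l3 \<alpha> \<alpha> \<beta> + l3 \<alpha> \<alpha> \<beta> + l3 \<alpha> \<alpha> \<beta>)
      + (l3 \<alpha> \<beta> \<beta> + l3 \<alpha> \<beta> \<beta> + l3 \<alpha> \<beta> \<beta>) + l3 \<beta> \<beta> \<beta>"
    unfolding add3[OF \<alpha> \<beta> \<alpha>\<beta> \<alpha>\<beta>] c1[OF \<alpha> \<alpha>\<beta>] c1[OF \<beta> \<alpha>\<beta>]
    using \<alpha> \<beta> by (simp add: c1 c2 c3 add_ac)
  then have "s (1 / 6) (l3 (\<alpha> + \<beta>) (\<alpha> + \<beta>) (\<alpha> + \<beta>)) = s (1 / 6) (l3 \<alpha> \<alpha> \<alpha>) + s (1 / 2) (l3 \<alpha> \<alpha> \<beta>)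
     + s (1 / 2) (l3 \<alpha> \<beta> \<beta>) + s (1 / 6) (l3 \<beta> \<beta> \<beta>)"
    by (simp only: scale_right_distrib[of _ "_ + _" "l3 \<beta> \<beta> \<beta>"] scale_right_distrib[of _ "l3 \<alpha> \<alpha> \<alpha> + _"]
      scale_right_distrib[of _ "l3 \<alpha> \<alpha> \<alpha>"] triple)
  \<comment> \<open>The right-hand side is the Maurer-Cartan expression at \<alpha>, which is zero,
    plus the twisted expression at \<beta>.\<close>
  with q have "s (1 / 2) (l2 (\<alpha> + \<beta>) (\<alpha> + \<beta>)) + s (1 / 6) (l3 (\<alpha> + \<beta>) (\<alpha> + \<beta>) (\<alpha> + \<beta>)) =
     (s (1 / 2) (l2 \<alpha> \<alpha>) + s (1 / 6) (l3 \<alpha> \<alpha> \<alpha>)) +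
     (l2 \<alpha> \<beta> + s (1 / 2) (l3 \<alpha> \<alpha> \<beta>) + s (1 / 2) (l2 \<beta> \<beta>) + s (1 / 2) (l3 \<alpha> \<beta> \<beta>)
     + s (1 / 6) (l3 \<beta> \<beta> \<beta>))"
    by (simp add: add_ac)
  with tw mc mc_iff[OF \<alpha>] mc_iff[OF \<alpha>\<beta>] show ?thesis by simp
qed

section \<open>Relative averaging algebras as Maurer-Cartan elements\<close>

lemma bilin_scale:
  assumes "bilin sU sV sW F"
  shows "F (sU c u) v = sW c (F u v)" "F u (sV c v) = sW c (F u v)"
  using assms by (auto simp: bilin_def Vector_Spaces.linear_iff)

lemma bilin_0:
  assumes "bilin sU sV sW F"
  shows "F 0 v = 0" "F u 0 = 0"
  using assms by (auto simp: bilin_def dest: linear_0)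

lemma bilin_plus:
  assumes "bilin sU sV sW F" "bilin sU sV sW G"
  shows "bilin sU sV sW (F + G)"
  using assms by (simp add: bilin_def Vector_Spaces.linear_iff vector_space_def algebra_simps)

lemma linear_plus:
  assumes "Vector_Spaces.linear s t F" "Vector_Spaces.linear s t G"
  shows "Vector_Spaces.linear s t (F + G)"
  using assms by (simp add: Vector_Spaces.linear_iff vector_space_def algebra_simps)

lemma vector_space_scaleD:
  assumes "vector_space sA" "vector_space sB"
  shows "vector_space (scaleD sA sB)"
proof -
  interpret A: vector_space sA by fact
  interpret B: vector_space sB by fact
  show ?thesis
    by unfold_locales
      (auto simp: scaleD_def prod_eq_iff A.scale_right_distrib B.scale_right_distrib
       A.scale_left_distrib B.scale_left_distrib)
qed

lemma T_distinct: "T_left \<noteq> T_right" "T_left \<noteq> T_perp" "T_right \<noteq> T_perp"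
  by (simp_all add: tree_names)

lemma pi_elt_pair:
  "pi_elt sB wt \<mu> \<nu> l r T [u, v] =
    (if T = T_left then (\<mu> (fst u) (fst v), r (snd u) (fst v))
     else if T = T_right then (\<mu> (fst u) (fst v), l (fst u) (snd v))
     else if T = T_perp then (\<mu> (fst u) (fst v), sB wt (\<nu> (snd u) (snd v)))
     else 0)"
  by (cases u; cases v) (simp add: pi_elt_def)

lemma pi_elt_not_pair: "length xs \<noteq> 2 \<Longrightarrow> pi_elt sB wt \<mu> \<nu> l r T xs = 0"
  by (auto simp: pi_elt_def split: list.splits)

lemma P_elt_single: "P_elt P T [u] = (if T = T_one then (P (snd u), 0) else 0)"
  by (cases u) (simp add: P_elt_def)

lemma P_elt_not_single: "length xs \<noteq> 1 \<Longrightarrow> P_elt P T xs = 0"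
  by (auto simp: P_elt_def split: list.splits)

text \<open>Quantifying over the image of \<open>R_pairs\<close> allows the trees to be replaced by
  the explicit list of axioms.\<close>

lemma comp_defect_eq_0_iff:
  "comp_defect f f = 0 \<longleftrightarrow>
    (\<forall>(T, T', S, S') \<in> R_pairs ` trees 3. \<forall>u v w. f T [f T' [u, v], w] = f S [u, f S' [v, w]])"
  (is "_ \<longleftrightarrow> ?R")
proof
  assume "comp_defect f f = 0"
  then have eq: "comp_defect f f T [u, v, w] = 0" for T u v w by simp
  have "f (R_outer 1 2 T) [f (R_inner 1 2 T) [u, v], w] = f (R_outer 2 2 T) [u, f (R_inner 2 2 T) [v, w]]"
    if "T \<in> trees 3" for T u v w
    using that eq[of T u v w] by (simp add: comp_defect_def)
  then show ?R by (auto simp: R_pairs_def)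
next
  assume ?R
  then have "comp_defect f f T xs = 0" for T xs
    by (simp add: comp_defect_def R_pairs_def del: split_paired_All)
  then show "comp_defect f f = 0" by (simp add: fun_eq_iff)
qed

lemma avg_term_eq_out_term_iff:
  "avg_term f h h = out_term f h \<longleftrightarrow>
    (\<forall>T\<in>trees 2. \<forall>u v. f T [h T_one [u], h T_one [v]]
        - h T_one [f T [h T_one [u], v] + f T [u, h T_one [v]]]
      = h T_one [f T [(0, snd u), (0, snd v)]])" (is "_ \<longleftrightarrow> ?R")
proof
  assume "avg_term f h h = out_term f h"
  then have eq: "avg_term f h h T [u, v] = out_term f h T [u, v]" for T u v by simp
  have "f T [h T_one [u], h T_one [v]] - h T_one [f T [h T_one [u], v] + f T [u, h T_one [v]]]
      = h T_one [f T [(0, snd u), (0, snd v)]]" if "T \<in> trees 2" for T u v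
    using that eq[of T u v] by (simp add: avg_term_def out_term_def)
  then show ?R by blast
next
  assume ?R
  then have "avg_term f h h T xs = out_term f h T xs" for T xs
    by (simp add: avg_term_def out_term_def del: split_paired_All)
  then show "avg_term f h h = out_term f h" by (simp add: fun_eq_iff)
qed

context
  fixes sA :: "'k::field \<Rightarrow> 'a::ab_group_add \<Rightarrow> 'a" and sB :: "'k \<Rightarrow> 'b::ab_group_add \<Rightarrow> 'b"
  assumes sA: "vector_space sA" and sB: "vector_space sB"
begin

interpretation A: vector_space sA by (rule sA)
interpretation B: vector_space sB by (rule sB)

lemma pi_elt_in_hh:
  assumes bil: "bilin sA sA sA \<mu>" "bilin sB sB sB \<nu>" "bilin sA sB sB l" "bilin sB sA sB r"
  shows "pi_elt sB wt \<mu> \<nu> l r \<in> \<hh>_grade sA sB 1"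
proof -
  let ?\<pi> = "pi_elt sB wt \<mu> \<nu> l r"
  have "multilinear (scaleD sA sB) 2 (?\<pi> T)" for T
    unfolding multilinear_2 bilin_def Vector_Spaces.linear_iff
    using vector_space_scaleD[OF sA sB]
    by (simp add: pi_elt_pair bil[THEN bilin_add(1)] bil[THEN bilin_add(2)]
      bil[THEN bilin_scale(1)] bil[THEN bilin_scale(2)] scaleD_def B.scale_right_distrib
      B.scale_left_commute zero_prod_def)
  moreover have "?\<pi> T xs = 0" if "T \<notin> trees 2 \<or> length xs \<noteq> 2" for T xs
  proof (cases "length xs = 2")
    case True
    then obtain u v where "xs = [u, v]" using list_length_2 by blast
    then show ?thesis using that by (simp add: pi_elt_pair trees_2)
  qed (simp add: pi_elt_not_pair)
  ultimately have coch: "?\<pi> \<in> cochains sA sB 2"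
    by (simp add: cochains_def)
  have word: "if \<forall>x\<in>set xs. in_A x then in_A (?\<pi> T xs) else in_B (?\<pi> T xs)"
    if xs: "\<forall>x\<in>set xs. in_A x \<or> in_B x" for T xs
  proof (cases "length xs = 2")
    case True
    then obtain u v where "xs = [u, v]" using list_length_2 by blast
    then show ?thesis using xs
      by (auto simp: pi_elt_pair in_A_def in_B_def bil[THEN bilin_0(1)] bil[THEN bilin_0(2)])
  qed (simp add: pi_elt_not_pair in_A_def in_B_def)
  show ?thesis
    using coch word by (simp add: \<hh>_grade_def \<gg>_grade_def)
qed

lemma P_elt_in_aa:
  assumes P: "Vector_Spaces.linear sB sA P"
  shows "P_elt P \<in> \<aa>_grade sA sB 0"
proof -
  have "multilinear (scaleD sA sB) 1 (P_elt P T)" for T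
    unfolding multilinear_1
    using vector_space_scaleD[OF sA sB] P
    by (simp add: Vector_Spaces.linear_iff P_elt_single scaleD_def zero_prod_def)
  moreover have "P_elt P T xs = 0" if "T \<notin> trees 1 \<or> length xs \<noteq> 1" for T xs
  proof (cases "length xs = 1")
    case True
    then obtain u where "xs = [u]" by (auto simp: length_Suc_conv)
    then show ?thesis using that by (simp add: P_elt_single trees_1)
  qed (simp add: P_elt_not_single)
  ultimately have coch: "P_elt P \<in> cochains sA sB 1"
    unfolding cochains_def by blast
  have word: "if \<forall>x\<in>set xs. in_B x then in_A (P_elt P T xs) else P_elt P T xs = 0"
    if xs: "\<forall>x\<in>set xs. in_A x \<or> in_B x" for T xs
  proof (cases "length xs = 1")
    case True
    then obtain u where "xs = [u]" by (auto simp: length_Suc_conv)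
    then show ?thesis using xs
      by (auto simp: P_elt_single in_A_def in_B_def linear_0[OF P] zero_prod_def)
  qed (simp add: P_elt_not_single in_A_def)
  show ?thesis
    using coch word by (simp add: \<aa>_grade_def \<gg>_grade_def)
qed

lemma relative_averaging_algebra_iff:
  assumes bil: "bilin sA sA sA \<mu>" "bilin sB sB sB \<nu>" "bilin sA sB sB l" "bilin sB sA sB r"
    and P: "Vector_Spaces.linear sB sA P" and wt: "wt \<noteq> 0"
  defines "f \<equiv> pi_elt sB wt \<mu> \<nu> l r"
  shows "relative_averaging_algebra sA sB wt \<mu> \<nu> l r P \<longleftrightarrow>
    comp_defect f f = 0 \<and> avg_term f (P_elt P) (P_elt P) = out_term f (P_elt P)"
proof -
  \<comment> \<open>In each of the eleven identities the A-component is associativity of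
    \<open>\<mu>\<close>. The B-components are associativity of \<open>\<nu>\<close> and the six
    bimodule axioms, some repeated; powers of \<open>wt\<close> cancel because it is
    nonzero.\<close>
  have "comp_defect f f = 0 \<longleftrightarrow> associative_algebra sA \<mu> \<and> associative_bimodule sA sB \<mu> \<nu> l r"
    unfolding comp_defect_eq_0_iff R_pairs_trees_3 f_def associative_algebra_def associative_bimodule_def
    using wt
    by (simp add: bil pi_elt_pair T_distinct T_distinct[symmetric] split_paired_All
      bil[THEN bilin_scale(1)] bil[THEN bilin_scale(2)]) auto
  moreover have "P (x + y) = P x + P y" "P (sB c x) = sA c (P x)" for x y c
    using P by (auto simp: Vector_Spaces.linear_iff)
  \<comment> \<open>\<open>T_left\<close> and \<open>T_right\<close> compare the product with P(r x
    (P y)) and P(l (P x) y), the right-hand side being zero; on \<open>T_perp\<close> the mixed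
    terms vanish and the right-hand side gives the weighted term.\<close>
  then have "avg_term f (P_elt P) (P_elt P) = out_term f (P_elt P) \<longleftrightarrow>
     (\<forall>x y. \<mu> (P x) (P y) = P (l (P x) y) \<and> P (l (P x) y) = P (r x (P y)) \<and> P (r x (P y)) = sA wt (P (\<nu> x y)))"
    unfolding avg_term_eq_out_term_iff trees_2 f_def
    by (simp add: pi_elt_pair P_elt_single T_distinct T_distinct[symmetric] split_paired_All
      bil[THEN bilin_0(1)] bil[THEN bilin_0(2)] linear_0[OF P]) metis
  ultimately show ?thesis
    using P by (simp add: relative_averaging_algebra_def)
qed

end

section \<open>The Maurer-Cartan equation of \<open>L_map\<close> and its twist\<close>

context
  fixes sA :: "'k::field_char_0 \<Rightarrow> 'a::ab_group_add \<Rightarrow> 'a" and sB :: "'k \<Rightarrow> 'b::ab_group_add \<Rightarrow> 'b"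
  assumes sA: "vector_space sA" and sB: "vector_space sB"
begin

lemma maurer_cartan_L_map_iff:
  assumes X: "X \<in> L_grade sA sB 0"
  shows "maurer_cartan (scaleL sA sB) (L_grade sA sB) L_map X \<longleftrightarrow>
    comp_defect (fst X) (fst X) = 0 \<and> avg_term (fst X) (snd X) (snd X) = out_term (fst X) (snd X)"
proof -
  interpret vector_space "scaleL sA sB" by (rule vector_space_scaleL[OF sA sB])
  let ?s = "scaleL sA sB"
  \<comment> \<open>On the diagonal l_2 consists of two copies of \<open>?W\<close> and l_3 of six
    copies of \<open>?V\<close>, matching the factors 1/2 and 1/6.\<close>
  let ?W = "(- comp_defect (fst X) (fst X), - out_term (fst X) (snd X))"
  let ?V = "(0 :: ('a, 'b) cochain, avg_term (fst X) (snd X) (snd X))"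
  have "?s (1 / 2) (?W + ?W) = ?s (1 / 2 + 1 / 2) ?W"
    by (simp only: scale_left_distrib scale_right_distrib)
  moreover have "L_two X X = ?W + ?W"
    by (simp add: L_two_def)
  ultimately have W: "?s (1 / 2) (L_two X X) = ?W" by simp
  have "?s (1 / 6) (?V + ?V + (?V + ?V) + (?V + ?V)) = ?s (1 / 6 + 1 / 6 + (1 / 6 + 1 / 6) + (1 / 6 + 1 / 6)) ?V"
    by (simp only: scale_left_distrib scale_right_distrib)
  moreover have "L_three X X X = ?V + ?V + (?V + ?V) + (?V + ?V)"
    by (simp add: L_three_def)
  ultimately have V: "?s (1 / 6) (L_three X X X) = ?V" by simp
  have "maurer_cartan ?s (L_grade sA sB) L_map X \<longleftrightarrow> ?W + ?V = 0"
    using maurer_cartan_cubic[of ?s X "L_grade sA sB" L_map] X vector_space_axioms W V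
    by (simp add: L_map_eq_0[of _ sA sB] set_replicate_conv_if L_map_2[OF X X] L_map_3[OF X X X])
  also have "\<dots> \<longleftrightarrow> comp_defect (fst X) (fst X) = 0 \<and> avg_term (fst X) (snd X) (snd X) = out_term (fst X) (snd X)"
    by (auto simp: prod_eq_iff)
  finally show ?thesis .
qed

lemma maurer_cartan_twist_L_map:
  assumes "X \<in> L_grade sA sB 0" "Y \<in> L_grade sA sB 0" "X + Y \<in> L_grade sA sB 0"
    and "maurer_cartan (scaleL sA sB) (L_grade sA sB) L_map X"
  shows "maurer_cartan (scaleL sA sB) (L_grade sA sB) (twist (scaleL sA sB) L_map X) Y \<longleftrightarrow>
    maurer_cartan (scaleL sA sB) (L_grade sA sB) L_map (X + Y)"
  by (rule maurer_cartan_twist_cubic[where ?l2.0 = L_two and ?l3.0 = L_three])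
    (rule vector_space_scaleL[OF sA sB] L_map_eq_0 L_map_2 L_map_3 L_two_commute L_three_commute
      L_two_add L_three_add assms | assumption)+

text \<open>Stated for arbitrary bilinear data, so that it applies to the given structure and to the
  deformed one.\<close>

lemma maurer_cartan_iff_relative_averaging_algebra:
  assumes bil: "bilin sA sA sA \<mu>" "bilin sB sB sB \<nu>" "bilin sA sB sB l" "bilin sB sA sB r"
    and P: "Vector_Spaces.linear sB sA P" and wt: "wt \<noteq> 0"
  shows "maurer_cartan (scaleL sA sB) (L_grade sA sB) L_map (pi_elt sB wt \<mu> \<nu> l r, P_elt P)
    \<longleftrightarrow> relative_averaging_algebra sA sB wt \<mu> \<nu> l r P"
  using maurer_cartan_L_map_iff[of "(pi_elt sB wt \<mu> \<nu> l r, P_elt P)"]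
    relative_averaging_algebra_iff[OF sA sB bil P wt] pi_elt_in_hh[OF sA sB bil, of wt] P_elt_in_aa[OF sA sB P]
  by (simp add: L_grade_def)

end

lemma pi_elt_add:
  fixes \<mu> \<mu>' :: "'a::ab_group_add \<Rightarrow> 'a \<Rightarrow> 'a"
  assumes "vector_space sB"
  shows "pi_elt sB wt (\<mu> + \<mu>') (\<nu> + \<nu>') (l + l') (r + r') = pi_elt sB wt \<mu> \<nu> l r + pi_elt sB wt \<mu>' \<nu>' l' r'"
proof (intro ext)
  interpret vector_space sB by fact
  fix T xs
  show "pi_elt sB wt (\<mu> + \<mu>') (\<nu> + \<nu>') (l + l') (r + r') T xs = (pi_elt sB wt \<mu> \<nu> l r + pi_elt sB wt \<mu>' \<nu>' l' r') T xs"
    by (auto simp: pi_elt_def scale_right_distrib split: list.splits)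
qed

lemma P_elt_add: "P_elt (P + P') = P_elt P + (P_elt P' :: ('a::ab_group_add, 'b::ab_group_add) cochain)"
  by (auto simp: P_elt_def fun_eq_iff split: list.splits)

theorem theorem5p12:
  fixes sA :: "'k::field_char_0 \<Rightarrow> 'a::ab_group_add \<Rightarrow> 'a"
    and sB :: "'k \<Rightarrow> 'b::ab_group_add \<Rightarrow> 'b"
    and wt :: 'k
    and \<mu> \<mu>' :: "'a \<Rightarrow> 'a \<Rightarrow> 'a"
    and \<nu> \<nu>' :: "'b \<Rightarrow> 'b \<Rightarrow> 'b"
    and l l' :: "'a \<Rightarrow> 'b \<Rightarrow> 'b"
    and r r' :: "'b \<Rightarrow> 'a \<Rightarrow> 'b"
    and P P' :: "'b \<Rightarrow> 'a"
  assumes "vector_space sA" and "vector_space sB"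
    and "wt \<noteq> 0"
    and "relative_averaging_algebra sA sB wt \<mu> \<nu> l r P"
    and "bilin sA sA sA \<mu>'" and "bilin sB sB sB \<nu>'"
    and "bilin sA sB sB l'" and "bilin sB sA sB r'"
    and "Vector_Spaces.linear sB sA P'"
  shows "relative_averaging_algebra sA sB wt (\<mu> + \<mu>') (\<nu> + \<nu>') (l + l') (r + r') (P + P')
     \<longleftrightarrow> maurer_cartan (scaleL sA sB) (L_grade sA sB)
           (twist (scaleL sA sB) L_map (pi_elt sB wt \<mu> \<nu> l r, P_elt P))
           (pi_elt sB wt \<mu>' \<nu>' l' r', P_elt P')"
proof -
  note sA = assms(1) and sB = assms(2) and wt = assms(3) and bil' = assms(5-8) and P' = assms(9)
  have bil: "bilin sA sA sA \<mu>" "bilin sB sB sB \<nu>" "bilin sA sB sB l" "bilin sB sA sB r"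
    and P: "Vector_Spaces.linear sB sA P"
    using assms(4)
    by (auto simp: relative_averaging_algebra_def associative_bimodule_def associative_algebra_def)
  let ?X = "(pi_elt sB wt \<mu> \<nu> l r, P_elt P)" and ?Y = "(pi_elt sB wt \<mu>' \<nu>' l' r', P_elt P')"
  \<comment> \<open>Deforming the structure maps is translation by \<open>?Y\<close>, which is what
    twisting at \<open>?X\<close> describes.\<close>
  have sum: "?X + ?Y = (pi_elt sB wt (\<mu> + \<mu>') (\<nu> + \<nu>') (l + l') (r + r'), P_elt (P + P'))"
    by (simp add: pi_elt_add[OF sB] P_elt_add)
  note bil'' = bilin_plus[OF bil(1) bil'(1)] bilin_plus[OF bil(2) bil'(2)]
    bilin_plus[OF bil(3) bil'(3)] bilin_plus[OF bil(4) bil'(4)]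
  note P'' = linear_plus[OF P P']
  have "?X \<in> L_grade sA sB 0" "?Y \<in> L_grade sA sB 0" "?X + ?Y \<in> L_grade sA sB 0"
    unfolding sum
    using pi_elt_in_hh[OF sA sB bil] P_elt_in_aa[OF sA sB P] pi_elt_in_hh[OF sA sB bil'] P_elt_in_aa[OF sA sB P']
      pi_elt_in_hh[OF sA sB bil''] P_elt_in_aa[OF sA sB P'']
    by (simp_all add: L_grade_def)
  moreover have "maurer_cartan (scaleL sA sB) (L_grade sA sB) L_map ?X"
    using maurer_cartan_iff_relative_averaging_algebra[OF sA sB bil P wt] assms(4) by simp
  ultimately have "maurer_cartan (scaleL sA sB) (L_grade sA sB) (twist (scaleL sA sB) L_map ?X) ?Y \<longleftrightarrow>
    maurer_cartan (scaleL sA sB) (L_grade sA sB) L_map (?X + ?Y)"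
    by (rule maurer_cartan_twist_L_map[OF sA sB])
  then show ?thesis
    unfolding sum maurer_cartan_iff_relative_averaging_algebra[OF sA sB bil'' P'' wt] by simp
qed

end
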